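(* Let $m\ge1$, let $B$ and $B'$ be $m$-level rook equivalent singleton boards, let $N$ be such that both $B$ and $B'$ fit inside $\Delta_{N,m}$, and let $0\le k<N$. Let $g:T\to T'$ be the Garsia–Milne bijection from $m$-level rook placements of $k$ rooks on $B$ to $m$-level rook placements of $k$ rooks on $B'$ described in the context. Then $g$ preserves the $m$-inversion number: for every $m$-level rook placement $\pi$ of $k$ rooks on $B$, $\mathrm{inv}_m(\pi)=\mathrm{inv}_m(g(\pi))$, where $\mathrm{inv}_m(\pi)$ is computed relative to $B$ and $\mathrm{inv}_m(g(\pi))$ relative to $B'$.
   Context: Fix an integer $m\ge 1$. A Ferrers board with columns of heights $0\le b_1\le\dots\le b_n$ consists of bottom-justified columns of these heights, left to right; boards differing only by empty columns on the left are identified. Level $p$ ($p\ge1$) consists of rows $(p-1)m+1,\dots,pm$, counted from the bottom. An $m$-level rook placement of $k$ rooks on $B$ is a set of $k$ cells of $B$, no two in the same column or the same level; $r_{k,m}(B)$ is the number of these; $B,B'$ are $m$-level rook equivalent if $r_{k,m}(B)=r_{k,m}(B')$ for all $k$. A column terminates in level $p$ if $p$ is the largest level it meets; $B$ is a singleton board if it is a Ferrers board and for each $p$ at most one column terminating in level $p$ has height not divisible by $m$. For an $m$-level rook placement $\pi$ on $B$, $\mathrm{inv}_m(\pi)$ is the number of cells $c$ of $B$ such that $c$ contains no rook, there is no rook above $c$ in the same column, and there is no rook to the left of $c$ in the same level. $\Delta_{n,m}$ is the Ferrers board $(0,m,2m,\dots,(n-1)m)$. $B$ fits inside $\Delta_{N,m}$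 if, on aligning lower right cells, $B$ is a subset of $\Delta_{N,m}$; then pad $B$ on the left with empty columns so $B=(b_0,\dots,b_{N-1})$ with $b_j\le jm$. If $B,B'$ are $m$-level rook equivalent singleton boards fitting inside $\Delta_{N,m}$, the sequences $(jm-b_j)_{0\le j<N}$ and $(jm-b'_j)_{0\le j<N}$ are rearrangements of each other (Briggs–Remmel). The set $S$. For $0\le i\le k$, a configuration $C\in S$ with $i$ white rooks consists of: $i$ white rooks in cells of $\Delta_{N,m}\setminus B$, no two in the same column; and $k-i$ black rooks forming an $m$-level rook placement on the inset board $\Delta_{N-i,m}$, which is formed from the $N-i$ columns of $\Delta_{N,m}$ containing no white rook by taking the bottom $jm$ cells of the $j$-th such column from the left ($j=0,1,\dots,N-i-1$). Black rooks may lie inside or outside $B$. The sign of $C$ is $(-1)^i$. The involution $I$. If all rooks of $C$ are in $B$ (hence black), $I(C)=C$; $T$ is the set of such $C$, identified with the set of $m$-level rook placements of $k$ rooks on $B$. Otherwise take the leftmost column with a rook outside $B$. If that rook is black, change it to white and move every black rook to its right in a higher level down $m$ cells. If it is white, change it to black and move every black rook to its right that is in the same or a higher level up $m$ cells. $(S',T',I')$ is defined in the same way from $B'$. The bijection $f:S\to S'$. For each length $d$, pair the columns of $\Delta_{N,m}\setminus B$ having exactly $d$ cells, from left to right, with the columns of $\Delta_{N,m}\setminus B'$ having exactly $d$ cells. A white rook in the $j$-th cell above $B$ in a column is sent to the $j$-th cell above $B'$ in the paired column. The black rooks are placed on the inset board $\Delta_{N-i,m}$ of the new configuration in the same positions,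 relative to the inset board, as they have in $C$. The bijection $g$. $g$ sends $t\in T$ to the first element of the sequence $x_0=f(t)$, $x_{j+1}=(f\circ I\circ f^{-1}\circ I')(x_j)$ that lies in $T'$; this is a bijection $T\to T'$. *)

theory Defs
  imports Main
begin

text \<open>
  A board is the list of its column heights, from left to right. Columns, rows and levels are all
  numbered from 0, so cell \<open>(x, y)\<close> is the one in column \<open>x\<close> with exactly \<open>y\<close> cells below it, and
  level \<open>p\<close> here is level \<open>p + 1\<close> in the numbering that starts at 1.
\<close>

type_synonym board = "nat list"
type_synonym cell = "nat \<times> nat"

definition cells :: "board \<Rightarrow> cell set" where
  "cells B = {(x, y). x < length B \<and> y < B ! x}"

definition level :: "nat \<Rightarrow> nat \<Rightarrow> nat" where
  "level m y = y div m"

definition ferrers :: "board \<Rightarrow> bool" where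
  "ferrers B \<longleftrightarrow> sorted B"

definition terminates_in :: "nat \<Rightarrow> board \<Rightarrow> nat \<Rightarrow> nat \<Rightarrow> bool" where
  "terminates_in m B x p \<longleftrightarrow>
     (\<exists>y. (x, y) \<in> cells B \<and> level m y = p) \<and> (\<forall>y. (x, y) \<in> cells B \<longrightarrow> level m y \<le> p)"

definition singleton_board :: "nat \<Rightarrow> board \<Rightarrow> bool" where
  "singleton_board m B \<longleftrightarrow> ferrers B \<and>
     (\<forall>p. card {x. x < length B \<and> terminates_in m B x p \<and> \<not> m dvd B ! x} \<le> 1)"

definition nonattacking :: "nat \<Rightarrow> cell set \<Rightarrow> bool" where
  "nonattacking m \<pi> \<longleftrightarrow>
     (\<forall>c\<in>\<pi>. \<forall>d\<in>\<pi>. c \<noteq> d \<longrightarrow> fst c \<noteq> fst d \<and> level m (snd c) \<noteq> level m (snd d))"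

definition rook_placements :: "nat \<Rightarrow> nat \<Rightarrow> board \<Rightarrow> cell set set" where
  "rook_placements m k B = {\<pi>. \<pi> \<subseteq> cells B \<and> card \<pi> = k \<and> nonattacking m \<pi>}"

definition rook_number :: "nat \<Rightarrow> nat \<Rightarrow> board \<Rightarrow> nat" where
  "rook_number m k B = card (rook_placements m k B)"

definition rook_equivalent :: "nat \<Rightarrow> board \<Rightarrow> board \<Rightarrow> bool" where
  "rook_equivalent m B B' \<longleftrightarrow> (\<forall>k. rook_number m k B = rook_number m k B')"

definition inversions :: "nat \<Rightarrow> board \<Rightarrow> cell set \<Rightarrow> nat" where
  "inversions m B \<pi> = card {(x, y). (x, y) \<in> cells B \<and> (x, y) \<notin> \<pi> \<and>
     \<not> (\<exists>y'. y < y' \<and> (x, y') \<in> \<pi>) \<and>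
     \<not> (\<exists>x' y'. x' < x \<and> level m y' = level m y \<and> (x', y') \<in> \<pi>)}"

definition Delta :: "nat \<Rightarrow> nat \<Rightarrow> board" where
  "Delta m n = map (\<lambda>j. j * m) [0..<n]"

text \<open>
  Boards differing only by empty columns on the left are identified; \<open>pad N B\<close> is the
  representative of \<open>B\<close> with \<open>N\<close> columns, provided \<open>B\<close> has at most \<open>N\<close> nonempty ones.
\<close>

definition pad :: "nat \<Rightarrow> board \<Rightarrow> board" where
  "pad N B = (let B\<^sub>0 = dropWhile (\<lambda>b. b = 0) B in replicate (N - length B\<^sub>0) 0 @ B\<^sub>0)"

definition fits_inside :: "nat \<Rightarrow> nat \<Rightarrow> board \<Rightarrow> bool" where
  "fits_inside m N B \<longleftrightarrow> length (pad N B) = N \<and> cells (pad N B) \<subseteq> cells (Delta m N)"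

text \<open>
  From here on boards are padded, so that \<open>N\<close> is the length of the list. A configuration is a pair
  \<open>(W, K)\<close> of the set of white rooks and the set of black rooks, both given by their cells in
  \<open>Delta m N\<close>.
\<close>

type_synonym configuration = "cell set \<times> cell set"

definition inset_columns :: "nat \<Rightarrow> cell set \<Rightarrow> nat list" where
  "inset_columns N W = sorted_list_of_set ({..<N} - fst ` W)"

definition inset_cells :: "nat \<Rightarrow> nat \<Rightarrow> cell set \<Rightarrow> cell set" where
  "inset_cells m N W =
     {(inset_columns N W ! j, y) | j y. j < length (inset_columns N W) \<and> y < j * m}"

definition configurations :: "nat \<Rightarrow> nat \<Rightarrow> board \<Rightarrow> configuration set" where
  "configurations m k B = {(W, K).
     W \<subseteq> cells (Delta m (length B)) - cells B \<and> inj_on fst W \<and>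
     K \<subseteq> inset_cells m (length B) W \<and> nonattacking m K \<and>
     card W + card K = k}"

definition all_in_board :: "board \<Rightarrow> configuration \<Rightarrow> bool" where
  "all_in_board B = (\<lambda>(W, K). W \<union> K \<subseteq> cells B)"

definition fixed_configurations :: "nat \<Rightarrow> nat \<Rightarrow> board \<Rightarrow> configuration set" where
  "fixed_configurations m k B = {C \<in> configurations m k B. all_in_board B C}"

definition black_to_white :: "nat \<Rightarrow> cell \<Rightarrow> configuration \<Rightarrow> configuration" where
  "black_to_white m = (\<lambda>(x, y) (W, K).
     (insert (x, y) W,
      (\<lambda>(x', y'). if x < x' \<and> level m y < level m y' then (x', y' - m) else (x', y'))
        ` (K - {(x, y)})))"

definition white_to_black :: "nat \<Rightarrow> cell \<Rightarrow> configuration \<Rightarrow> configuration" where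
  "white_to_black m = (\<lambda>(x, y) (W, K).
     (W - {(x, y)},
      insert (x, y)
        ((\<lambda>(x', y'). if x < x' \<and> level m y \<le> level m y' then (x', y' + m) else (x', y')) ` K)))"

text \<open>A column of a configuration contains at most one rook, so the rook below is unique.\<close>

definition leftmost_outside :: "board \<Rightarrow> configuration \<Rightarrow> cell" where
  "leftmost_outside B = (\<lambda>(W, K).
     (THE c. c \<in> (W \<union> K) - cells B \<and> (\<forall>d \<in> (W \<union> K) - cells B. fst c \<le> fst d)))"

definition involution :: "nat \<Rightarrow> board \<Rightarrow> configuration \<Rightarrow> configuration" where
  "involution m B C =
     (if all_in_board B C then C
      else let c = leftmost_outside B C in
        if c \<in> snd C then black_to_white m c C else white_to_black m c C)"

definition gap_columns :: "nat \<Rightarrow> board \<Rightarrow> nat \<Rightarrow> nat list" where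
  "gap_columns m B d = filter (\<lambda>j. j * m - B ! j = d) [0..<length B]"

definition transfer_white :: "nat \<Rightarrow> board \<Rightarrow> board \<Rightarrow> cell set \<Rightarrow> cell set" where
  "transfer_white m B B' W =
     {(x', B' ! x' + i) | x x' i. (x, B ! x + i) \<in> W \<and>
        (\<exists>d r. r < length (gap_columns m B d) \<and> r < length (gap_columns m B' d) \<and>
               x = gap_columns m B d ! r \<and> x' = gap_columns m B' d ! r)}"

definition transfer_black :: "nat \<Rightarrow> cell set \<Rightarrow> cell set \<Rightarrow> cell set \<Rightarrow> cell set" where
  "transfer_black N W W' K =
     {(inset_columns N W' ! j, y) | j y.
        j < length (inset_columns N W) \<and> (inset_columns N W ! j, y) \<in> K}"

definition transfer :: "nat \<Rightarrow> board \<Rightarrow> board \<Rightarrow> configuration \<Rightarrow> configuration" where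
  "transfer m B B' = (\<lambda>(W, K).
     let W' = transfer_white m B B' W in (W', transfer_black (length B) W W' K))"

definition garsia_milne_seq ::
  "nat \<Rightarrow> nat \<Rightarrow> board \<Rightarrow> board \<Rightarrow> configuration \<Rightarrow> nat \<Rightarrow> configuration" where
  "garsia_milne_seq m k B B' t j =
     ((transfer m B B' \<circ> involution m B \<circ>
       inv_into (configurations m k B) (transfer m B B') \<circ> involution m B') ^^ j)
     (transfer m B B' t)"

text \<open>
  Fixed configurations have no white rooks, so \<open>\<pi> \<mapsto> ({}, \<pi>)\<close> and \<open>snd\<close> are the identification of
  rook placements on the board with fixed configurations.
\<close>

definition garsia_milne :: "nat \<Rightarrow> nat \<Rightarrow> board \<Rightarrow> board \<Rightarrow> cell set \<Rightarrow> cell set" where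
  "garsia_milne m k B B' \<pi> =
     (let x = garsia_milne_seq m k B B' ({}, \<pi>)
      in snd (x (LEAST j. x j \<in> fixed_configurations m k B')))"

end

theory Submission
  imports Defs "HOL-Computational_Algebra.Polynomial"
begin

text \<open>
  On a singleton board every level met by a column is full in all columns to its right. Counting
  placements column by column therefore gives
  \<open>\<Sum>k. r k * x (x - m) \<dots> (x - (N - k - 1) m) = \<Prod>j. (x - (j m - b j))\<close>,
  and unique factorization shows that the gaps \<open>j m - b j\<close> of rook equivalent boards are
  rearrangements of each other.

  Assign to a configuration the number of inversions of its black rooks relative to the inset board
  plus the number of cells of \<open>Delta m N\<close> above each white rook. The transfer map preserves both
  summands. The involution preserves the sum: the leftmost rook outside the board has only black
  rooks inside the board to its left, all in lower levels, so as a black rook it contributes exactly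
  the cells above it, and it cancels for the columns to its right exactly the level that disappears
  from the inset board when it turns white. On a placement inside the board this statistic exceeds
  the number of inversions by the sum of the gaps, because a cell outside the board is never
  cancelled. Hence every Garsia-Milne step preserves inversions, and the iteration reaches a fixed
  configuration because the involutions reverse the sign outside the fixed configurations.
\<close>

section \<open>Rook equivalent singleton boards have the same gaps\<close>

text \<open>For positive \<open>m\<close> this says that \<open>b\<close> rounded up to a multiple
  of \<open>m\<close> is at most \<open>b'\<close>. The quantification over cells makes it directly
  applicable to the level of a rook.\<close>

definition covers :: "nat \<Rightarrow> nat \<Rightarrow> nat \<Rightarrow> bool" where
  "covers m b b' \<longleftrightarrow> (\<forall>y<b. (y div m + 1) * m \<le> b')"

lemma covers_0 [simp]: "covers m 0 b"
  by (simp add: covers_def)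

text \<open>If the level of \<open>y\<close> met by column \<open>i\<close> were not full in the
  later column \<open>j\<close>, then both columns would end strictly inside that level. Two columns
  terminating in one level with heights not divisible by \<open>m\<close> are excluded on a
  singleton board.\<close>

lemma singleton_board_covers:
  assumes "m \<ge> 1" "singleton_board m B"
  shows "sorted_wrt (covers m) B"
proof (rule sorted_wrt_iff_nth_less[THEN iffD2], intro allI impI)
  fix i j assume ij: "i < j" "j < length B"
  show "covers m (B ! i) (B ! j)"
    unfolding covers_def
  proof (intro allI impI, rule ccontr)
    fix y assume y: "y < B ! i" and neg: "\<not> (y div m + 1) * m \<le> B ! j"
    let ?p = "y div m"
    let ?X = "{x. x < length B \<and> terminates_in m B x ?p \<and> \<not> m dvd B ! x}"
    have le: "B ! i \<le> B ! j"
      using assms(2) ij by (auto simp: singleton_board_def ferrers_def sorted_iff_nth_mono)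
    have low: "?p * m \<le> y" by simp
    \<comment> \<open>Stated for every height between those of columns \<open>i\<close> and
      \<open>j\<close>, so that one argument serves both columns.\<close>
    have mem: "x \<in> ?X" if x: "x < length B" "B ! i \<le> B ! x" "B ! x \<le> B ! j" for x
    proof -
      have "(x, y) \<in> cells B" using x y by (auto simp: cells_def)
      moreover have "level m z \<le> ?p" if "(x, z) \<in> cells B" for z
      proof -
        have "z < (?p + 1) * m" using that x neg by (auto simp: cells_def)
        then show ?thesis
          using less_mult_imp_div_less[of z "?p + 1" m] by (simp add: level_def)
      qed
      moreover have "\<not> m dvd B ! x"
      proof
        assume "m dvd B ! x"
        then obtain q where q: "B ! x = m * q" by blast
        have "?p * m < q * m" using low y x q unfolding mult.commute[of m q] by linarith
        moreover have "q * m < (?p + 1) * m" using neg x q by (simp add: mult.commute)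
        ultimately have "?p < q" "q < ?p + 1" by (meson mult_less_cancel2)+
        then show False by simp
      qed
      ultimately show ?thesis using x by (auto simp: terminates_in_def level_def)
    qed
    have "{i, j} \<subseteq> ?X" using mem[of i] mem[of j] ij le by auto
    then have "card {i, j} \<le> card ?X" by (intro card_mono) auto
    moreover have "card ?X \<le> 1" using assms(2) by (simp add: singleton_board_def)
    ultimately show False using ij by simp
  qed
qed

section \<open>Counting placements by the rook in the last column\<close>

lemma card_free_cells:
  assumes "m \<ge> 1" "finite L" "\<And>p. p \<in> L \<Longrightarrow> (p + 1) * m \<le> b"
  shows "int (card {y. y < b \<and> y div m \<notin> L}) = int b - int (card L * m)"
proof -
  have div_iff: "y div m = p \<longleftrightarrow> y \<in> {p * m..<(p + 1) * m}" for y p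
    using assms(1) dividend_less_times_div[of m y]
    by (auto intro!: div_nat_eqI simp: algebra_simps)
  \<comment> \<open>By the assumption on \<open>L\<close> each of its levels lies entirely below
    height \<open>b\<close>, so no interval has to be cut off at \<open>b\<close> and each one
    accounts for exactly \<open>m\<close> cells.\<close>
  have eq: "{y. y < b \<and> y div m \<in> L} = (\<Union>p\<in>L. {p * m..<(p + 1) * m})"
  proof -
    have "y < b" if "y div m \<in> L" for y
      using assms(3)[OF that] div_iff[of y "y div m"] by auto
    then show ?thesis unfolding set_eq_iff UN_iff div_iff[symmetric] by blast
  qed
  have "card (\<Union>p\<in>L. {p * m..<(p + 1) * m}) = (\<Sum>p\<in>L. card {p * m..<(p + 1) * m})"
    proof (rule card_UN_disjoint)
    show "\<forall>p\<in>L. \<forall>q\<in>L. p \<noteq> q \<longrightarrow> {p * m..<(p + 1) * m} \<inter> {q * m..<(q + 1) * m} = {}"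
      unfolding disjoint_iff div_iff[symmetric] by blast
  qed (use assms(2) in auto)
  then have used: "card {y. y < b \<and> y div m \<in> L} = card L * m" by (simp add: eq)
  have "{..<b} = {y. y < b \<and> y div m \<notin> L} \<union> {y. y < b \<and> y div m \<in> L}" by auto
  then have "card {..<b} = card {y. y < b \<and> y div m \<notin> L} + card {y. y < b \<and> y div m \<in> L}"
    by (simp only:) (rule card_Un_disjoint, auto)
  then have "int b = int (card {y. y < b \<and> y div m \<notin> L}) + int (card L * m)"
    unfolding used card_lessThan by (metis of_nat_add)
  then show ?thesis by linarith
qed

lemma finite_cells [simp]: "finite (cells B)"
proof -
  have "cells B = (SIGMA x:{..<length B}. {..<B ! x})" by (auto simp: cells_def)
  then show ?thesis by simp
qed

lemma finite_rook_placements [simp]: "finite (rook_placements m k B)"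
  by (rule finite_subset[of _ "Pow (cells B)"]) (auto simp: rook_placements_def)

lemma rook_placements_finite: "\<pi> \<in> rook_placements m k B \<Longrightarrow> finite \<pi>"
  unfolding rook_placements_def using finite_subset finite_cells by blast

lemma rook_number_0 [simp]: "rook_number m 0 B = 1"
proof -
  have "\<pi> = {}" if "\<pi> \<in> rook_placements m 0 B" for \<pi>
    using that rook_placements_finite[OF that] by (simp add: rook_placements_def)
  moreover have "{} \<in> rook_placements m 0 B"
    by (simp add: rook_placements_def nonattacking_def)
  ultimately have "rook_placements m 0 B = {{}}" by blast
  then show ?thesis by (simp add: rook_number_def)
qed

lemma cells_snoc: "cells (B @ [b]) = cells B \<union> {length B} \<times> {..<b}"
  by (auto simp: cells_def nth_append less_Suc_eq split: if_splits)

text \<open>Either the last column is empty, or removing its rook leaves \<open>k\<close> rooks on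
  \<open>B\<close> whose levels all differ from the level of the removed rook.\<close>

lemma rook_placements_snoc:
  "rook_placements m (Suc k) (B @ [b]) = rook_placements m (Suc k) B \<union>
     (\<lambda>(\<pi>, y). insert (length B, y) \<pi>) `
       (SIGMA \<pi>:rook_placements m k B. {y. y < b \<and> y div m \<notin> (\<lambda>c. level m (snd c)) ` \<pi>})"
  (is "?L = ?R1 \<union> ?R2")
proof (intro equalityI subsetI)
  fix \<pi> assume \<pi>: "\<pi> \<in> ?L"
  show "\<pi> \<in> ?R1 \<union> ?R2"
  proof (cases "\<pi> \<subseteq> cells B")
    case True
    then show ?thesis using \<pi> by (auto simp: rook_placements_def)
  next
    case False
    then obtain y where y: "(length B, y) \<in> \<pi>" "y < b"
      using \<pi> by (auto simp: rook_placements_def cells_snoc)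
    let ?\<rho> = "\<pi> - {(length B, y)}"
    have na: "nonattacking m \<pi>" and sub: "\<pi> \<subseteq> cells B \<union> {length B} \<times> {..<b}"
      using \<pi> by (auto simp: rook_placements_def cells_snoc)
    have "?\<rho> \<subseteq> cells B"
    proof
      fix c assume c: "c \<in> ?\<rho>"
      then have "fst c \<noteq> length B" using na y unfolding nonattacking_def by fastforce
      then show "c \<in> cells B" using c sub by auto
    qed
    moreover have "card ?\<rho> = k"
      using \<pi> y by (simp add: rook_placements_def)
    moreover have "nonattacking m ?\<rho>" using na by (auto simp: nonattacking_def)
    moreover have "y div m \<notin> (\<lambda>c. level m (snd c)) ` ?\<rho>"
      using na y unfolding nonattacking_def level_def by fastforce
    ultimately have "(?\<rho>, y) \<in> (SIGMA \<pi>:rook_placements m k B.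
        {y. y < b \<and> y div m \<notin> (\<lambda>c. level m (snd c)) ` \<pi>})"
      using y by (simp add: rook_placements_def)
    moreover have "\<pi> = insert (length B, y) ?\<rho>" using y by auto
    ultimately show ?thesis by (intro UnI2 image_eqI[of _ _ "(?\<rho>, y)"]) auto
  qed
next
  fix \<pi> assume "\<pi> \<in> ?R1 \<union> ?R2"
  then show "\<pi> \<in> ?L"
  proof
    assume "\<pi> \<in> ?R1"
    then show ?thesis by (auto simp: rook_placements_def cells_snoc)
  next
    assume "\<pi> \<in> ?R2"
    then obtain \<rho> y where \<rho>: "\<rho> \<in> rook_placements m k B" and y: "y < b"
      "y div m \<notin> (\<lambda>c. level m (snd c)) ` \<rho>" and eq: "\<pi> = insert (length B, y) \<rho>"
      by auto
    have out: "fst c \<noteq> length B" if "c \<in> \<rho>" for c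
      using \<rho> that by (auto simp: rook_placements_def cells_def)
    then have "(length B, y) \<notin> \<rho>" by fastforce
    then have "card \<pi> = Suc k"
      using \<rho> eq rook_placements_finite[OF \<rho>] by (simp add: rook_placements_def)
    moreover have "nonattacking m \<pi>"
      unfolding nonattacking_def
    proof (intro ballI impI)
      fix c d assume cd: "c \<in> \<pi>" "d \<in> \<pi>" "c \<noteq> d"
      have "nonattacking m \<rho>" using \<rho> by (simp add: rook_placements_def)
      moreover have new: "level m (snd c) \<noteq> level m y" if "c \<in> \<rho>" for c
        using y(2) that unfolding level_def image_iff by metis
      ultimately show "fst c \<noteq> fst d \<and> level m (snd c) \<noteq> level m (snd d)"
        using cd new[of c] new[of d] out[of c] out[of d] unfolding eq nonattacking_def
        by (elim insertE) (simp_all, metis+)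
    qed
    ultimately show ?thesis using \<rho> y eq by (auto simp: rook_placements_def cells_snoc)
  qed
qed

text \<open>The \<open>k\<close> rooks on \<open>B\<close> occupy \<open>k\<close> distinct levels,
  and by \<open>covers\<close> each of them is full in the new column. Hence the number of free
  cells is \<open>b - k * m\<close> for every placement. Over the integers this difference can be
  negative, but only if there is no placement of \<open>k\<close> rooks on \<open>B\<close>.\<close>

lemma rook_number_snoc:
  assumes m: "m \<ge> 1" and cov: "sorted_wrt (covers m) (B @ [b])"
  shows "int (rook_number m (Suc k) (B @ [b])) =
    int (rook_number m (Suc k) B) + (int b - int (k * m)) * int (rook_number m k B)"
proof -
  let ?free = "\<lambda>\<pi>. {y. y < b \<and> y div m \<notin> (\<lambda>c. level m (snd c)) ` \<pi>}"
  let ?ins = "\<lambda>(\<pi>, y). insert (length B, y) \<pi>"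
  let ?D = "SIGMA \<pi>:rook_placements m k B. ?free \<pi>"
  have out: "fst c \<noteq> length B" if "\<pi> \<in> rook_placements m l B" "c \<in> \<pi>" for \<pi> c l
    using that by (auto simp: rook_placements_def cells_def)
  have inj: "inj_on ?ins ?D"
  proof (rule inj_onI, clarsimp)
    fix \<pi> y \<rho> z
    assume *: "\<pi> \<in> rook_placements m k B" "\<rho> \<in> rook_placements m k B"
      "insert (length B, y) \<pi> = insert (length B, z) \<rho>"
    have n: "(length B, w) \<notin> \<pi>" "(length B, w) \<notin> \<rho>" for w
      using out[OF *(1)] out[OF *(2)] by fastforce+
    have "y = z" using *(3) n by blast
    moreover have "\<pi> = \<rho>" using *(3) n \<open>y = z\<close> by (metis insert_ident)
    ultimately show "\<pi> = \<rho> \<and> y = z" by simp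
  qed
  have free: "int (card (?free \<pi>)) = int b - int (k * m)" if \<pi>: "\<pi> \<in> rook_placements m k B" for \<pi>
  proof -
    have "inj_on (\<lambda>c. level m (snd c)) \<pi>"
      using \<pi> unfolding rook_placements_def nonattacking_def by (intro inj_onI) blast
    then have card: "card ((\<lambda>c. level m (snd c)) ` \<pi>) = k"
      using \<pi> by (simp add: card_image rook_placements_def)
    have "(p + 1) * m \<le> b" if p: "p \<in> (\<lambda>c. level m (snd c)) ` \<pi>" for p
    proof -
      obtain x y where xy: "(x, y) \<in> \<pi>" "p = y div m" using p by (auto simp: level_def)
      then have "x < length B" "y < B ! x" using \<pi> by (auto simp: rook_placements_def cells_def)
      moreover have "covers m (B ! x) b" using cov \<open>x < length B\<close> by (auto simp: sorted_wrt_append)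
      ultimately show ?thesis using xy by (auto simp: covers_def)
    qed
    then show ?thesis using card_free_cells[of m "(\<lambda>c. level m (snd c)) ` \<pi>" b] m card
      rook_placements_finite[OF \<pi>] by simp
  qed
  have finD: "finite ?D" by auto
  have "rook_placements m (Suc k) B \<inter> ?ins ` ?D = {}" using out by fastforce
  then have "rook_number m (Suc k) (B @ [b]) = rook_number m (Suc k) B + card (?ins ` ?D)"
    unfolding rook_number_def rook_placements_snoc using finD by (subst card_Un_disjoint) auto
  moreover have "card (?ins ` ?D) = (\<Sum>\<pi>\<in>rook_placements m k B. card (?free \<pi>))"
    by (subst card_image[OF inj]) (simp add: card_SigmaI)
  moreover have "(\<Sum>\<pi>\<in>rook_placements m k B. int (card (?free \<pi>))) =
      (int b - int (k * m)) * int (rook_number m k B)"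
    by (simp only: free sum_constant rook_number_def mult.commute of_nat_sum cong: sum.cong)
  ultimately show ?thesis by simp
qed

text \<open>The heights are listed from right to left, so that the recursion removes the last column.\<close>

fun rook_count :: "nat \<Rightarrow> nat list \<Rightarrow> nat \<Rightarrow> int" where
  "rook_count m [] k = (if k = 0 then 1 else 0)"
| "rook_count m (b # bs) 0 = rook_count m bs 0"
| "rook_count m (b # bs) (Suc k) =
     rook_count m bs (Suc k) + (int b - int (k * m)) * rook_count m bs k"

lemma rook_number_eq_rook_count:
  assumes "m \<ge> 1" "sorted_wrt (covers m) B"
  shows "int (rook_number m k B) = rook_count m (rev B) k"
  using assms(2)
proof (induction B arbitrary: k rule: rev_induct)
  case Nil
  have "rook_number m (Suc k) [] = 0" for k
    by (auto simp: rook_number_def rook_placements_def cells_def)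
  then show ?case by (cases k) simp_all
next
  case (snoc b B)
  have IH: "int (rook_number m k B) = rook_count m (rev B) k" for k
    using snoc by (simp add: sorted_wrt_append)
  show ?case
  proof (cases k)
    case 0
    then show ?thesis using IH[of 0] by simp
  next
    case (Suc l)
    then show ?thesis using rook_number_snoc[OF assms(1) snoc.prems] IH by simp
  qed
qed

text \<open>Empty columns on the left stand at the end of the reversed list. There the factor
  \<open>int 0 - int (k * m)\<close> vanishes for \<open>k = 0\<close>, and for larger
  \<open>k\<close> the count it multiplies is already zero.\<close>

lemma rook_count_append_zeros: "rook_count m (bs @ replicate n 0) k = rook_count m bs k"
proof (induction m bs k rule: rook_count.induct)
  case (1 m k)
  show ?case
  proof (induction n arbitrary: k)
    case (Suc n)
    then show ?case by (cases k) simp_all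
  qed simp
qed simp_all

section \<open>Factorization of the rook polynomial\<close>

lemma rook_count_eq_0: "length bs < k \<Longrightarrow> rook_count m bs k = 0"
  by (induction m bs k rule: rook_count.induct) simp_all

text \<open>Induction on the last column. With \<open>n\<close> columns before it, the new factor
  \<open>x - (n * m - b)\<close> is the sum of \<open>x - (n - k) * m\<close>, which lengthens the
  falling product by one factor, and \<open>b - k * m\<close>, which is the coefficient in the
  recursion of \<open>rook_count\<close>.\<close>

lemma rook_count_factorization:
  "(\<Sum>k\<le>length B. rook_count m (rev B) k * (\<Prod>i<length B - k. x - int (i * m))) =
   (\<Prod>j<length B. x - (int (j * m) - int (B ! j)))"
proof (induction B rule: rev_induct)
  case (snoc b B)
  let ?n = "length B"
  let ?c = "rook_count m (rev B)"
  let ?F = "\<lambda>l. \<Prod>i<l. x - int (i * m)"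
  have "(\<Sum>k\<le>Suc ?n. rook_count m (b # rev B) k * ?F (Suc ?n - k)) =
      ?c 0 * ?F (Suc ?n) + (\<Sum>k\<le>?n. (?c (Suc k) + (int b - int (k * m)) * ?c k) * ?F (?n - k))"
    by (subst sum.atMost_Suc_shift) simp
  also have "\<dots> = (?c 0 * ?F (Suc ?n) + (\<Sum>k\<le>?n. ?c (Suc k) * ?F (?n - k))) +
      (\<Sum>k\<le>?n. (int b - int (k * m)) * ?c k * ?F (?n - k))"
    by (simp only: distrib_right sum.distrib add.assoc)
  also have "?c 0 * ?F (Suc ?n) + (\<Sum>k\<le>?n. ?c (Suc k) * ?F (?n - k)) =
      (\<Sum>k\<le>Suc ?n. ?c k * ?F (Suc ?n - k))"
    by (subst sum.atMost_Suc_shift) simp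
  also have "\<dots> = (\<Sum>k\<le>?n. ?c k * ?F (Suc ?n - k))"
    by (simp add: rook_count_eq_0)
  also have "\<dots> = (\<Sum>k\<le>?n. ?c k * ?F (?n - k) * (x - int ((?n - k) * m)))"
    by (intro sum.cong) (simp_all add: Suc_diff_le)
  \<comment> \<open>For each \<open>k\<close> the two coefficients add up to an expression without
    \<open>k\<close>, which can then be taken out of the sum.\<close>
  also have "\<dots> + (\<Sum>k\<le>?n. (int b - int (k * m)) * ?c k * ?F (?n - k)) =
      (\<Sum>k\<le>?n. ?c k * ?F (?n - k) * (x - (int (?n * m) - int b)))"
    unfolding sum.distrib[symmetric]
    by (intro sum.cong) (auto simp: of_nat_diff algebra_simps)
  also have "\<dots> = (\<Prod>j<?n. x - (int (j * m) - int (B ! j))) * (x - (int (?n * m) - int b))"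
    unfolding sum_distrib_right[symmetric] snoc.IH ..
  also have "\<dots> = (\<Prod>j<Suc ?n. x - (int (j * m) - int ((B @ [b]) ! j)))"
    by (simp add: nth_append)
  finally show ?case by simp
qed simp

text \<open>Evaluation at an element of one multiset gives zero, so that element is a root of the
  other product and belongs to the other multiset. Its linear factor is then cancelled on both
  sides.\<close>

lemma prod_linear_factors_unique:
  fixes M M' :: "int multiset"
  assumes "(\<Prod>a\<in>#M. [:- a, 1:]) = (\<Prod>a\<in>#M'. [:- a, 1:])"
  shows "M = M'"
  using assms
proof (induction M arbitrary: M')
  case empty
  show ?case
  proof (cases M')
    case (add a N)
    then have "poly (1 :: int poly) a = poly (\<Prod>a\<in>#M'. [:- a, 1:]) a" using empty by simp
    then show ?thesis using add by simp
  qed simp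
next
  case (add a M)
  have "poly (\<Prod>a\<in>#M'. [:- a, 1:]) a = poly (\<Prod>a\<in>#add_mset a M. [:- a, 1:]) a"
    using add.prems by simp
  also have "\<dots> = 0" by simp
  finally have "(\<Prod>b\<in>#M'. a - b) = 0"
    by (simp add: poly_prod_mset)
  then have "a \<in># M'" by (auto simp: prod_mset_zero_iff)
  then obtain N where N: "M' = add_mset a N" by (meson mset_add)
  have "[:- a, 1:] \<noteq> (0 :: int poly)" by simp
  moreover have "[:- a, 1:] * (\<Prod>a\<in>#M. [:- a, 1:]) = [:- a, 1:] * (\<Prod>a\<in>#N. [:- a, 1:])"
    using add.prems unfolding N by (simp only: image_mset_add_mset prod_mset.add_mset)
  ultimately have "(\<Prod>a\<in>#M. [:- a, 1:]) = (\<Prod>a\<in>#N. [:- a, 1:])"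
    by (rule mult_left_cancel[THEN iffD1])
  then show ?case using add.IH N by simp
qed

text \<open>A multiset, so that equality means being a rearrangement. The truncated subtraction is
  the true difference for boards inside \<open>Delta m N\<close>.\<close>

definition gaps :: "nat \<Rightarrow> board \<Rightarrow> nat multiset" where
  "gaps m B = mset (map (\<lambda>j. j * m - B ! j) [0..<length B])"

text \<open>Equal rook counts give equal values of the two factorizations at every integer
  \<open>x\<close>. The polynomials with the gaps as roots therefore coincide, and so do their
  multisets of roots. The bounds \<open>le\<close> turn truncated into integer subtraction.\<close>

lemma gaps_eq_if_rook_count_eq:
  assumes len: "length B = length B'"
    and le: "\<And>j. j < length B \<Longrightarrow> B ! j \<le> j * m" "\<And>j. j < length B' \<Longrightarrow> B' ! j \<le> j * m"
    and eq: "\<And>k. rook_count m (rev B) k = rook_count m (rev B') k"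
  shows "gaps m B = gaps m B'"
proof -
  have poly_eq: "poly (\<Prod>a\<in>#image_mset int (gaps m C). [:- a, 1:]) x =
      (\<Prod>j<length C. x - (int (j * m) - int (C ! j)))"
    if "\<And>j. j < length C \<Longrightarrow> C ! j \<le> j * m" for C x
  proof -
    have "poly (\<Prod>a\<in>#image_mset int (gaps m C). [:- a, 1:]) x =
        (\<Prod>j\<in>#mset_set {..<length C}. x - int (j * m - C ! j))"
      by (simp add: gaps_def poly_prod_mset image_mset.compositionality comp_def
          atLeast0LessThan mset_upt)
    also have "\<dots> = (\<Prod>j<length C. x - int (j * m - C ! j))"
      by (simp add: prod_unfold_prod_mset)
    finally show ?thesis using that by (simp add: of_nat_diff)
  qed
  have "poly (\<Prod>a\<in>#image_mset int (gaps m B). [:- a, 1:]) =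
        poly (\<Prod>a\<in>#image_mset int (gaps m B'). [:- a, 1:])"
  proof
    fix x
    show "poly (\<Prod>a\<in>#image_mset int (gaps m B). [:- a, 1:]) x =
        poly (\<Prod>a\<in>#image_mset int (gaps m B'). [:- a, 1:]) x"
      using poly_eq[OF le(1), of x] poly_eq[OF le(2), of x] len eq
        rook_count_factorization[of m B x] rook_count_factorization[of m B' x] by simp
  qed
  then have "image_mset int (gaps m B) = image_mset int (gaps m B')"
    by (intro prod_linear_factors_unique) (simp only: poly_eq_poly_eq_iff)
  then show ?thesis by (simp add: multiset.inj_map_strong[of _ _ int int])
qed

section \<open>Padding with empty columns\<close>

lemma sorted_wrt_covers_zeros:
  "sorted_wrt (covers m) (replicate n 0 @ B) \<longleftrightarrow> sorted_wrt (covers m) B"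
  by (induction n) auto

lemma zeros_dropWhile: "\<exists>n. B = replicate n 0 @ dropWhile (\<lambda>b. b = 0) (B :: nat list)"
proof -
  have "takeWhile (\<lambda>b. b = 0) B = replicate (length (takeWhile (\<lambda>b. b = 0) B)) 0"
    by (rule replicate_length_same[symmetric]) (auto dest: set_takeWhileD)
  then show ?thesis by (metis takeWhile_dropWhile_id)
qed

lemma pad_covers:
  assumes "sorted_wrt (covers m) B"
  shows "sorted_wrt (covers m) (pad N B)"
proof -
  let ?B = "dropWhile (\<lambda>b. b = 0) B"
  obtain n where "B = replicate n 0 @ ?B" using zeros_dropWhile by blast
  then have "sorted_wrt (covers m) (replicate n 0 @ ?B)" using assms by simp
  then show ?thesis by (simp add: pad_def Let_def sorted_wrt_covers_zeros)
qed

lemma rook_count_pad: "rook_count m (rev (pad N B)) k = rook_count m (rev B) k"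
proof -
  let ?B = "dropWhile (\<lambda>b. b = 0) B"
  obtain n where "B = replicate n 0 @ ?B" using zeros_dropWhile by blast
  then have "rook_count m (rev B) k = rook_count m (rev ?B) k"
    by (metis rev_append rev_replicate rook_count_append_zeros)
  then show ?thesis by (simp add: pad_def Let_def rook_count_append_zeros)
qed

lemma fits_inside_le:
  assumes "fits_inside m N B" "j < N"
  shows "pad N B ! j \<le> j * m"
proof (rule ccontr)
  assume "\<not> pad N B ! j \<le> j * m"
  \<comment> \<open>The cell \<open>(j, j * m)\<close> is the lowest cell of column \<open>j\<close>
    that is not in \<open>Delta m N\<close>.\<close>
  then have "(j, j * m) \<in> cells (pad N B)" using assms by (auto simp: cells_def fits_inside_def)
  then have "(j, j * m) \<in> cells (Delta m N)" using assms by (auto simp: fits_inside_def)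
  then show False using assms(2) by (auto simp: cells_def Delta_def)
qed

lemma rook_equivalent_gaps_eq:
  assumes "m \<ge> 1" "singleton_board m B" "singleton_board m B'" "rook_equivalent m B B'"
    "fits_inside m N B" "fits_inside m N B'"
  shows "gaps m (pad N B) = gaps m (pad N B')"
proof (rule gaps_eq_if_rook_count_eq)
  have len: "length (pad N B) = N" "length (pad N B') = N"
    using assms by (auto simp: fits_inside_def)
  then show "length (pad N B) = length (pad N B')" by simp
  show "\<And>j. j < length (pad N B) \<Longrightarrow> pad N B ! j \<le> j * m"
    "\<And>j. j < length (pad N B') \<Longrightarrow> pad N B' ! j \<le> j * m"
    using len fits_inside_le assms by auto
  show "rook_count m (rev (pad N B)) k = rook_count m (rev (pad N B')) k" for k
    using assms rook_number_eq_rook_count[of m B k] rook_number_eq_rook_count[of m B' k]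
      singleton_board_covers[of m B] singleton_board_covers[of m B']
    by (simp add: rook_count_pad rook_equivalent_def)
qed

section \<open>The involution\<close>

definition rank :: "cell set \<Rightarrow> nat \<Rightarrow> nat" where
  "rank W x = card ({..<x} - fst ` W)"

lemma inset_columns_less:
  "i < j \<Longrightarrow> j < length (inset_columns N W) \<Longrightarrow> inset_columns N W ! i < inset_columns N W ! j"
  unfolding inset_columns_def
  using sorted_wrt_iff_nth_less[THEN iffD1, OF strict_sorted_list_of_set] by blast

lemma inset_columns_less_iff:
  assumes "i < length (inset_columns N W)" "j < length (inset_columns N W)"
  shows "inset_columns N W ! i < inset_columns N W ! j \<longleftrightarrow> i < j"
    "inset_columns N W ! i = inset_columns N W ! j \<longleftrightarrow> i = j"
  using assms inset_columns_less[of i j N W] inset_columns_less[of j i N W]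
  by (metis less_asym nat_neq_iff)+

lemma set_inset_columns: "set (inset_columns N W) = {..<N} - fst ` W"
  by (simp add: inset_columns_def)

lemma inset_columns_cases:
  assumes "x < N" "x \<notin> fst ` W"
  obtains j where "j < length (inset_columns N W)" "x = inset_columns N W ! j"
  using assms set_inset_columns[of N W] by (metis DiffI in_set_conv_nth lessThan_iff)

lemma inset_columns_nth:
  assumes "j < length (inset_columns N W)"
  shows "inset_columns N W ! j < N" "inset_columns N W ! j \<notin> fst ` W"
  using assms set_inset_columns[of N W] nth_mem[OF assms] by auto

text \<open>Identifies the index of a column in the sorted list with the number of columns without
  white rooks to its left. Inset cells can then be described by \<open>rank\<close> instead of list
  positions.\<close>

lemma rank_inset_columns:
  assumes j: "j < length (inset_columns N W)"
  shows "rank W (inset_columns N W ! j) = j"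
proof -
  let ?L = "inset_columns N W"
  have "{..<?L ! j} - fst ` W = (!) ?L ` {..<j}"
  proof (intro equalityI subsetI)
    fix x assume x: "x \<in> {..<?L ! j} - fst ` W"
    then have "x < N" using inset_columns_nth(1)[OF j] by simp
    then obtain i where i: "i < length ?L" "x = ?L ! i" using x by (auto elim: inset_columns_cases)
    then show "x \<in> (!) ?L ` {..<j}" using x j inset_columns_less_iff(1) by auto
  next
    fix x assume "x \<in> (!) ?L ` {..<j}"
    then obtain i where i: "i < j" "x = ?L ! i" by auto
    then show "x \<in> {..<?L ! j} - fst ` W"
      using j inset_columns_less[OF i(1) j] inset_columns_nth(2)[of i N W] by auto
  qed
  moreover have "inj_on ((!) ?L) {..<j}"
    using j inset_columns_less_iff(2)[of _ N W] by (intro inj_onI) auto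
  ultimately show ?thesis by (simp add: rank_def card_image)
qed

lemma inset_cells_eq:
  "inset_cells m N W = {(x, y). x < N \<and> x \<notin> fst ` W \<and> y < rank W x * m}"
proof (intro equalityI subsetI)
  fix c assume "c \<in> inset_cells m N W"
  then show "c \<in> {(x, y). x < N \<and> x \<notin> fst ` W \<and> y < rank W x * m}"
    unfolding inset_cells_def using inset_columns_nth[of _ N W] by (auto simp: rank_inset_columns)
next
  fix c assume "c \<in> {(x, y). x < N \<and> x \<notin> fst ` W \<and> y < rank W x * m}"
  then obtain x y where c: "c = (x, y)" "x < N" "x \<notin> fst ` W" "y < rank W x * m" by auto
  obtain j where j: "j < length (inset_columns N W)" "x = inset_columns N W ! j"
    using c by (auto elim: inset_columns_cases)
  then show "c \<in> inset_cells m N W" using c by (auto simp: inset_cells_def rank_inset_columns)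
qed

lemma mem_inset_cells:
  "c \<in> inset_cells m N W \<longleftrightarrow> fst c < N \<and> fst c \<notin> fst ` W \<and> snd c < rank W (fst c) * m"
  by (simp add: inset_cells_eq split_def)

lemma rank_insert_le: "x' \<le> x \<Longrightarrow> rank (insert (x, y) W) x' = rank W x'"
  unfolding rank_def by (rule arg_cong[of _ _ card]) auto

text \<open>A new white rook in column \<open>x\<close> takes that column out of the inset board, so
  every column to its right becomes one level lower.\<close>

lemma rank_insert_gt:
  assumes "x < x'" "x \<notin> fst ` W"
  shows "Suc (rank (insert (x, y) W) x') = rank W x'"
proof -
  let ?S = "{..<x'} - fst ` insert (x, y) W"
  have "card (insert x ?S) = Suc (card ?S)" by (rule card_insert_disjoint) auto
  moreover have "insert x ?S = {..<x'} - fst ` W" using assms by auto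
  ultimately show ?thesis by (simp only: rank_def)
qed

lemma rank_eq_self: "(\<And>w. w \<in> W \<Longrightarrow> x \<le> fst w) \<Longrightarrow> rank W x = x"
proof -
  assume "\<And>w. w \<in> W \<Longrightarrow> x \<le> fst w"
  then have "{..<x} - fst ` W = {..<x}" by fastforce
  then show ?thesis by (simp add: rank_def)
qed

lemma rank_mono: "x \<le> x' \<Longrightarrow> rank W x \<le> rank W x'"
  unfolding rank_def by (rule card_mono) auto

section \<open>The statistic and the moves of single cells\<close>

definition uncancelled :: "nat \<Rightarrow> cell set \<Rightarrow> cell \<Rightarrow> bool" where
  "uncancelled m K c \<longleftrightarrow> c \<notin> K \<and> \<not> (\<exists>y'. snd c < y' \<and> (fst c, y') \<in> K) \<and>
     \<not> (\<exists>x' y'. x' < fst c \<and> level m y' = level m (snd c) \<and> (x', y') \<in> K)"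

text \<open>\<open>uncancelled\<close> is the inversion condition without reference to a board, so
  that it applies to the inset board as well as to \<open>B\<close>. As rows start at 0,
  \<open>x * m - 1 - y\<close> is the number of cells of \<open>Delta m N\<close> above
  \<open>(x, y)\<close>.\<close>

definition statistic :: "nat \<Rightarrow> nat \<Rightarrow> configuration \<Rightarrow> nat" where
  "statistic m N = (\<lambda>(W, K). card {c \<in> inset_cells m N W. uncancelled m K c} +
     (\<Sum>(x, y)\<in>W. x * m - 1 - y))"

text \<open>Defined on arbitrary cells because it has to move the uncancelled empty cells along with
  the rooks when the inset board changes.\<close>

definition raise_rook :: "nat \<Rightarrow> cell \<Rightarrow> cell \<Rightarrow> cell" where
  "raise_rook m c d =
     (if fst c < fst d \<and> level m (snd c) \<le> level m (snd d) then (fst d, snd d + m) else d)"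

definition lower_rook :: "nat \<Rightarrow> cell \<Rightarrow> cell \<Rightarrow> cell" where
  "lower_rook m c d =
     (if fst c < fst d \<and> level m (snd c) < level m (snd d) then (fst d, snd d - m) else d)"

lemma white_to_black_eq: "white_to_black m c (W, K) = (W - {c}, insert c (raise_rook m c ` K))"
proof -
  obtain x y where c: "c = (x, y)" by (cases c)
  have "raise_rook m (x, y) =
      (\<lambda>(x', y'). if x < x' \<and> level m y \<le> level m y' then (x', y' + m) else (x', y'))"
    by (simp add: fun_eq_iff raise_rook_def)
  then show ?thesis by (simp add: c white_to_black_def)
qed

lemma black_to_white_eq: "black_to_white m c (W, K) = (insert c W, lower_rook m c ` (K - {c}))"
proof -
  obtain x y where c: "c = (x, y)" by (cases c)
  have "lower_rook m (x, y) =
      (\<lambda>(x', y'). if x < x' \<and> level m y < level m y' then (x', y' - m) else (x', y'))"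
    by (simp add: fun_eq_iff lower_rook_def)
  then show ?thesis by (simp add: c black_to_white_def)
qed

lemma fst_raise_rook [simp]: "fst (raise_rook m c d) = fst d"
  by (simp add: raise_rook_def)

lemma fst_lower_rook [simp]: "fst (lower_rook m c d) = fst d"
  by (simp add: lower_rook_def)

lemma level_add: "0 < m \<Longrightarrow> level m (y + m) = Suc (level m y)"
  by (simp add: level_def)

lemma level_diff: "level m y > p \<Longrightarrow> level m (y - m) = level m y - 1"
proof -
  assume "level m y > p"
  \<comment> \<open>Division by 0 yields 0, so a positive level forces both that \<open>m\<close> is
    positive and that \<open>y\<close> is at least \<open>m\<close>.\<close>
  then have "m > 0" "m \<le> y" using div_less[of y m] by (auto simp: level_def intro!: gr0I leI)
  then show ?thesis using level_add[of m "y - m"] by simp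
qed

lemma level_less_iff: "0 < m \<Longrightarrow> level m y < p \<longleftrightarrow> y < p * m"
  by (simp add: level_def div_less_iff_less_mult)

lemma level_mono: "y \<le> y' \<Longrightarrow> level m y \<le> level m y'"
  by (simp add: level_def div_le_mono)

lemma level_raise_rook:
  "0 < m \<Longrightarrow> level m (snd (raise_rook m c d)) =
     (if fst c < fst d \<and> level m (snd c) \<le> level m (snd d) then Suc (level m (snd d))
      else level m (snd d))"
  by (simp add: raise_rook_def level_add)

lemma lower_raise_rook: "0 < m \<Longrightarrow> lower_rook m c (raise_rook m c d) = d"
  by (auto simp: lower_rook_def raise_rook_def level_add)

text \<open>The excluded cells, to the right of \<open>c\<close> in its own level, are exactly those
  outside the range of \<open>raise_rook m c\<close>. They are also the cells which a rook at
  \<open>c\<close> cancels in later columns.\<close>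

lemma raise_lower_rook:
  assumes "0 < m" "fst c < fst d \<Longrightarrow> level m (snd d) \<noteq> level m (snd c)"
  shows "raise_rook m c (lower_rook m c d) = d"
proof (cases "fst c < fst d \<and> level m (snd c) < level m (snd d)")
  case True
  then have "m \<le> snd d" by (metis level_def div_less leI not_less_zero)
  moreover have "level m (snd c) \<le> level m (snd d - m)"
    using True level_diff[of "level m (snd c)" m "snd d"] by linarith
  ultimately show ?thesis using True by (simp add: lower_rook_def raise_rook_def)
next
  case False
  then show ?thesis using assms by (auto simp: lower_rook_def raise_rook_def)
qed

text \<open>Within one column the shifted cells form an upper segment, so the order is unchanged.
  This preserves the property of lying below a rook.\<close>

lemma raise_rook_less_iff:
  assumes "0 < m" "fst d = fst e"
  shows "snd (raise_rook m c d) < snd (raise_rook m c e) \<longleftrightarrow> snd d < snd e"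
proof -
  have "level m (snd d) \<le> level m (snd e)" if "snd d < snd e" using that by (simp add: level_mono)
  moreover have "level m (snd e) \<le> level m (snd d)" if "snd e \<le> snd d" using that by (rule level_mono)
  ultimately show ?thesis using assms by (cases "snd d < snd e") (auto simp: raise_rook_def)
qed

text \<open>The property behind the definite description in \<open>leftmost_outside\<close>; as a
  relation it can be shown to hold of the same cell before and after a move.\<close>

definition is_leftmost_outside :: "board \<Rightarrow> cell \<Rightarrow> configuration \<Rightarrow> bool" where
  "is_leftmost_outside B c = (\<lambda>(W, K).
     c \<in> (W \<union> K) - cells B \<and> (\<forall>d \<in> (W \<union> K) - cells B. fst c \<le> fst d))"

section \<open>Configurations over a fixed board\<close>

locale covered_board =
  fixes m N :: nat and B :: board
  assumes m_pos: "0 < m" and length_B: "length B = N"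
    and covers_B: "sorted_wrt (covers m) B" and le_B: "\<And>j. j < N \<Longrightarrow> B ! j \<le> j * m"
begin

lemma configurations_iff:
  "(W, K) \<in> configurations m k B \<longleftrightarrow>
     (\<forall>x y. (x, y) \<in> W \<longrightarrow> x < N \<and> B ! x \<le> y \<and> y < x * m) \<and> inj_on fst W \<and>
     (\<forall>x y. (x, y) \<in> K \<longrightarrow> x < N \<and> x \<notin> fst ` W \<and> y < rank W x * m) \<and>
     nonattacking m K \<and> card W + card K = k"
proof -
  have "W \<subseteq> cells (Delta m N) - cells B \<longleftrightarrow>
      (\<forall>x y. (x, y) \<in> W \<longrightarrow> x < N \<and> B ! x \<le> y \<and> y < x * m)"
    by (fastforce simp: cells_def Delta_def length_B subset_iff not_less)
  moreover have "K \<subseteq> inset_cells m N W \<longleftrightarrow>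
      (\<forall>x y. (x, y) \<in> K \<longrightarrow> x < N \<and> x \<notin> fst ` W \<and> y < rank W x * m)"
    unfolding inset_cells_eq by auto
  ultimately show ?thesis by (simp add: configurations_def length_B)
qed

lemma finite_inset_cells: "finite (inset_cells m N W)"
proof -
  have "inset_cells m N W = (SIGMA x:{..<N} - fst ` W. {..<rank W x * m})"
    by (auto simp: inset_cells_eq)
  then show ?thesis by simp
qed

lemma configurations_finite:
  assumes "(W, K) \<in> configurations m k B"
  shows "finite W" "finite K"
proof -
  have "W \<subseteq> cells (Delta m N)" "K \<subseteq> inset_cells m N W"
    using assms by (auto simp: configurations_def length_B)
  then show "finite W" "finite K" using finite_subset finite_cells finite_inset_cells by blast+
qed

lemma finite_configurations: "finite (configurations m k B)"
proof -
  let ?D = "cells (Delta m N)"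
  have "rank W x \<le> x" for W x
    using card_mono[of "{..<x}" "{..<x} - fst ` W"] by (simp add: rank_def)
  then have "y < x * m" if "y < rank W x * m" for W x y
    using that by (meson less_le_trans mult_le_mono1)
  moreover have "(x, y) \<in> ?D \<longleftrightarrow> x < N \<and> y < x * m" for x y
    by (auto simp: cells_def Delta_def)
  ultimately have "W \<subseteq> ?D \<and> K \<subseteq> ?D" if "(W, K) \<in> configurations m k B" for W K
    using that unfolding configurations_iff subset_iff split_paired_All by blast
  then have "configurations m k B \<subseteq> Pow ?D \<times> Pow ?D" by auto
  then show ?thesis by (rule finite_subset) simp
qed

text \<open>A column holds at most one rook: white columns are removed from the inset board, and
  rooks of one colour never share a column. So two leftmost candidates, which share a column, are
  equal.\<close>

lemma is_leftmost_outside_unique: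
  assumes C: "(W, K) \<in> configurations m k B"
    and c: "is_leftmost_outside B c (W, K)"
  shows "leftmost_outside B (W, K) = c"
proof -
  have "d = c" if "d \<in> W \<union> K" "fst d = fst c" for d
  proof -
    have "c \<in> W \<union> K" using c by (simp add: is_leftmost_outside_def)
    moreover have "fst w \<noteq> fst e" if "w \<in> W" "e \<in> K" for w e
      using C that unfolding configurations_iff by (metis imageI prod.collapse)
    moreover have "inj_on fst W" "nonattacking m K" using C by (auto simp: configurations_iff)
    ultimately show ?thesis
      using that unfolding nonattacking_def inj_on_def by (metis UnE)
  qed
  note same_column = this
  show ?thesis
    unfolding leftmost_outside_def split
  proof (rule the_equality)
    show c': "c \<in> (W \<union> K) - cells B \<and> (\<forall>d \<in> (W \<union> K) - cells B. fst c \<le> fst d)"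
      using c by (simp add: is_leftmost_outside_def)
    fix d assume d: "d \<in> (W \<union> K) - cells B \<and> (\<forall>e \<in> (W \<union> K) - cells B. fst d \<le> fst e)"
    then have "fst d = fst c" using c' by (meson le_antisym)
    then show "d = c" using same_column d by blast
  qed
qed

lemma is_leftmost_outside_exists:
  assumes C: "(W, K) \<in> configurations m k B" and "\<not> all_in_board B (W, K)"
  obtains c where "is_leftmost_outside B c (W, K)"
proof -
  let ?O = "(W \<union> K) - cells B"
  have "finite ?O" "?O \<noteq> {}"
    using assms configurations_finite[OF C] by (auto simp: all_in_board_def)
  then have "Min (fst ` ?O) \<in> fst ` ?O" by (intro Min_in) auto
  then obtain c where "c \<in> ?O" "fst c = Min (fst ` ?O)" by (metis (no_types, lifting) imageE)
  then have "is_leftmost_outside B c (W, K)"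
    using \<open>finite ?O\<close> by (auto simp: is_leftmost_outside_def)
  then show ?thesis by (rule that)
qed

section \<open>The leftmost rook outside the board\<close>

context
  fixes W K :: "cell set" and x y k :: nat
  assumes C: "(W, K) \<in> configurations m k B" and L: "is_leftmost_outside B (x, y) (W, K)"
begin

lemma leftmost_column: "x < N" "B ! x \<le> y"
proof -
  show "x < N" using C L by (auto simp: configurations_iff is_leftmost_outside_def)
  then show "B ! x \<le> y" using L by (auto simp: is_leftmost_outside_def cells_def length_B)
qed

lemma left_in_board: "d \<in> W \<union> K \<Longrightarrow> fst d < x \<Longrightarrow> d \<in> cells B"
proof (rule ccontr)
  assume d: "d \<in> W \<union> K" "fst d < x" "d \<notin> cells B"
  then have "x \<le> fst d" using L unfolding is_leftmost_outside_def by simp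
  then show False using d(2) by simp
qed

lemma white_right: "w \<in> W \<Longrightarrow> x \<le> fst w"
proof (rule ccontr)
  assume w: "w \<in> W" "\<not> x \<le> fst w"
  then have "w \<in> cells B" using left_in_board by simp
  then show False using C w(1) by (cases w) (force simp: configurations_iff cells_def)
qed

text \<open>White rooks lie outside \<open>B\<close>, so none is to the left of \<open>x\<close>,
  and no inset column up to \<open>x\<close> has been lowered.\<close>

lemma rank_left: "x' \<le> x \<Longrightarrow> rank W x' = x'"
  by (rule rank_eq_self) (rule order_trans[OF _ white_right])

text \<open>A level met by a column is full in all columns to its right, whereas \<open>(x, y)\<close> lies above \<open>B\<close>.\<close>

lemma left_lower_level: "d \<in> K \<Longrightarrow> fst d < x \<Longrightarrow> level m (snd d) < level m y"
proof -
  assume d: "d \<in> K" "fst d < x"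
  then have "d \<in> cells B" using left_in_board by simp
  then have "snd d < B ! fst d" by (auto simp: cells_def)
  moreover have "covers m (B ! fst d) (B ! x)"
    using covers_B d leftmost_column by (auto simp: sorted_wrt_iff_nth_less length_B)
  ultimately have "(level m (snd d) + 1) * m \<le> y"
    using leftmost_column by (auto simp: covers_def level_def)
  then have "\<not> level m y < level m (snd d) + 1" using level_less_iff[OF m_pos] by (simp add: not_less)
  then show ?thesis by simp
qed

text \<open>A black rook is bounded by the inset board, whose column \<open>x\<close> still has the
  height of the column of \<open>Delta m N\<close>. Hence the cell is also legal for a white
  rook.\<close>

lemma leftmost_below_diagonal: "y < x * m"
proof (cases "(x, y) \<in> W")
  case True
  then show ?thesis using C by (auto simp: configurations_iff)
next
  case False
  then have "(x, y) \<in> K" using L by (auto simp: is_leftmost_outside_def)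
  then have "y < rank W x * m" using C by (simp add: configurations_iff)
  then show ?thesis using rank_left[of x] by simp
qed

end

text \<open>Raising vacates the level of \<open>y\<close> to the right of \<open>x\<close> for the
  new black rook, and the columns there become one level higher, which absorbs the shift by
  \<open>m\<close>. For the statistic, \<open>raise_rook\<close> maps the old uncancelled cells
  injectively to new ones. The only ones missed are the cells above \<open>(x, y)\<close> in column
  \<open>x\<close>, and these are what the white rook had contributed.\<close>

lemma white_to_black:
  assumes C: "(W, K) \<in> configurations m k B" and L: "is_leftmost_outside B (x, y) (W, K)"
    and xy: "(x, y) \<in> W"
  defines "W' \<equiv> W - {(x, y)}" and "K' \<equiv> insert (x, y) (raise_rook m (x, y) ` K)"
  shows "(W', K') \<in> configurations m k B" "is_leftmost_outside B (x, y) (W', K')"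
    "lower_rook m (x, y) ` (K' - {(x, y)}) = K" "card W = Suc (card W')"
    "statistic m N (W', K') = statistic m N (W, K)"
proof -
  note left_lower_level = left_lower_level[OF C L] and rank_left = rank_left[OF C L]
  note col = leftmost_column[OF C L] and yx = leftmost_below_diagonal[OF C L]
  let ?r = "raise_rook m (x, y)"
  have fin: "finite W" "finite K" using configurations_finite[OF C] .
  have W: "W = insert (x, y) W'" using xy by (auto simp: W'_def)
  have injW: "inj_on fst W" and naK: "nonattacking m K"
    and inW: "\<And>a b. (a, b) \<in> W \<Longrightarrow> a < N \<and> B ! a \<le> b \<and> b < a * m"
    and inK: "\<And>a b. (a, b) \<in> K \<Longrightarrow> a < N \<and> a \<notin> fst ` W \<and> b < rank W a * m"
    using C by (auto simp: configurations_iff)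
  have xW': "x \<notin> fst ` W'"
  proof
    assume "x \<in> fst ` W'"
    then obtain w where "w \<in> W'" "fst w = x" by auto
    then have "w = (x, y)" using injW xy by (auto simp: inj_on_def W'_def)
    then show False using \<open>w \<in> W'\<close> by (simp add: W'_def)
  qed
  have xK: "fst d \<noteq> x" if "d \<in> K" for d
  proof
    assume "fst d = x"
    then have "x \<notin> fst ` W" using inK[of "fst d" "snd d"] that by (metis prod.collapse)
    then show False using xy by force
  qed
  have rank_le: "rank W' a = rank W a" if "a \<le> x" for a
    using rank_insert_le[OF that] W by simp
  have rank_gt: "rank W' a = Suc (rank W a)" if "x < a" for a
    using rank_insert_gt[OF that xW'] W by simp
  have r_inj: "inj_on ?r K"
    by (rule inj_on_inverseI[of _ "lower_rook m (x, y)"]) (simp add: lower_raise_rook m_pos)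
  have noK: "(x, b) \<notin> ?r ` K" for b
  proof
    assume "(x, b) \<in> ?r ` K"
    then obtain d where "d \<in> K" "(x, b) = ?r d" by blast
    then show False using xK by (metis fst_conv fst_raise_rook)
  qed
  then have xyr: "(x, y) \<notin> ?r ` K" .
  have r_level: "level m (snd (?r d)) =
      (if level m y \<le> level m (snd d) then Suc (level m (snd d)) else level m (snd d))"
    if "d \<in> K" for d
    using left_lower_level[OF that] xK[OF that] by (auto simp: level_raise_rook m_pos)
  show card_W: "card W = Suc (card W')" 
    unfolding W'_def using fin(1) xy by (rule card.remove)
  show "lower_rook m (x, y) ` (K' - {(x, y)}) = K"
    using xyr by (simp add: K'_def image_image lower_raise_rook m_pos)
  have rank_le': "rank W a \<le> rank W' a" for a using rank_le[of a] rank_gt[of a] by (cases "a \<le> x") auto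
  \<comment> \<open>Stated for arbitrary cells, since it is applied to black rooks and later to
    uncancelled cells.\<close>
  have raise_cell: "a < N \<and> a \<notin> fst ` W' \<and> b < rank W' a * m"
    if ab: "(a, b) = ?r (a, b')" and b': "a < N" "a \<notin> fst ` W" "b' < rank W a * m" for a b b'
  proof -
    have "rank W a * m \<le> rank W' a * m" using rank_le' by simp
    then have "b' < rank W' a * m" using b'(3) by linarith
    moreover have "b' + m < rank W' a * m" if "x < a" using rank_gt[OF that] b'(3) by simp
    moreover have "a \<notin> fst ` W'" using b'(2) W by auto
    ultimately show ?thesis using b'(1) ab by (auto simp: raise_rook_def split: if_splits)
  qed
  have inK': "a < N \<and> a \<notin> fst ` W' \<and> b < rank W' a * m" if abK: "(a, b) \<in> K'" for a b
  proof (cases "(a, b) = (x, y)")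
    case True
    then show ?thesis using col xW' yx rank_le[of x] rank_left[of x] by simp
  next
    case False
    then obtain d where "d \<in> K" "(a, b) = ?r d" using abK unfolding K'_def by blast
    then show ?thesis using raise_cell[of a b "snd d"] inK[of "fst d" "snd d"]
      by (metis fst_conv fst_raise_rook prod.collapse)
  qed
  have "nonattacking m K'"
    unfolding nonattacking_def
  proof (intro ballI impI)
    fix c d assume cd: "c \<in> K'" "d \<in> K'" "c \<noteq> d"
    \<comment> \<open>On levels, raising acts by an injective map that skips the level of
      \<open>y\<close>. This separates the raised rooks from the new one and from each
      other.\<close>
    have new: "fst (?r e) \<noteq> x \<and> level m (snd (?r e)) \<noteq> level m y" if "e \<in> K" for e
      using xK[OF that] r_level[OF that] by auto
    have old: "fst (?r e) \<noteq> fst (?r e') \<and> level m (snd (?r e)) \<noteq> level m (snd (?r e'))"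
      if "e \<in> K" "e' \<in> K" "e \<noteq> e'" for e e'
      using naK that r_level[of e] r_level[of e'] unfolding nonattacking_def by (auto split: if_splits)
    show "fst c \<noteq> fst d \<and> level m (snd c) \<noteq> level m (snd d)"
      using cd(1,2) unfolding K'_def
    proof (elim insertE imageE)
      fix e assume "c = (x, y)" "d = ?r e" "e \<in> K" then show ?thesis using new[of e] by auto
    next
      fix e assume "d = (x, y)" "c = ?r e" "e \<in> K" then show ?thesis using new[of e] by auto
    next
      fix e e' assume "c = ?r e" "d = ?r e'" "e \<in> K" "e' \<in> K"
      then show ?thesis using old[of e e'] cd(3) by auto
    qed (use cd(3) in simp)
  qed
  moreover have "card W' + card K' = k"
    using C card_W fin xyr r_inj by (simp add: configurations_iff K'_def card_image)
  moreover have "inj_on fst W'" using injW by (auto simp: W'_def inj_on_def)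
  moreover have "a < N \<and> B ! a \<le> b \<and> b < a * m" if "(a, b) \<in> W'" for a b
    using inW that unfolding W'_def by blast
  ultimately show "(W', K') \<in> configurations m k B" using inK' by (simp add: configurations_iff)
  have "fst d \<ge> x" if d: "d \<in> W' \<union> K'" "d \<notin> cells B" for d
  proof (rule ccontr)
    assume "\<not> x \<le> fst d"
    then have dx: "fst d < x" by simp
    then have "d \<in> W \<union> K" using d(1) by (auto simp: W'_def K'_def raise_rook_def)
    then show False using left_in_board[OF C L] dx d(2) by simp
  qed
  moreover have "(x, y) \<notin> cells B" using col by (simp add: cells_def)
  moreover have "(x, y) \<in> W' \<union> K'" by (simp add: K'_def)
  ultimately show "is_leftmost_outside B (x, y) (W', K')"
    unfolding is_leftmost_outside_def split fst_conv by blast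
  let ?A = "{c \<in> inset_cells m N W. uncancelled m K c}"
  let ?A' = "{c \<in> inset_cells m N W'. uncancelled m K' c}"
  \<comment> \<open>The part of column \<open>x\<close> above the rook. This column belongs only to
    the larger inset board, where it has height \<open>x * m\<close>.\<close>
  let ?new = "{x} \<times> {y<..<x * m}"
  have A_col: "fst c \<noteq> x" if "c \<in> inset_cells m N W" for c
  proof -
    have "x \<in> fst ` W" using xy by (metis fst_conv imageI)
    then show ?thesis using that by (metis mem_inset_cells)
  qed
  have xyK': "(x, y) \<in> K'" by (simp add: K'_def)
  have uncancelled_raise: "uncancelled m K' (?r c) \<longleftrightarrow> uncancelled m K c" if cx: "fst c \<noteq> x" for c
  proof -
    have "inj ?r" by (rule inj_on_inverseI[of _ "lower_rook m (x, y)"]) (simp add: lower_raise_rook m_pos)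
    moreover have "?r c \<noteq> (x, y)" using cx by (metis fst_conv fst_raise_rook)
    ultimately have "?r c \<in> K' \<longleftrightarrow> c \<in> K" by (simp add: K'_def inj_image_mem_iff)
    moreover have "(\<exists>b'. snd (?r c) < b' \<and> (fst c, b') \<in> K') \<longleftrightarrow> (\<exists>b'. snd c < b' \<and> (fst c, b') \<in> K)"
    proof
      assume "\<exists>b'. snd (?r c) < b' \<and> (fst c, b') \<in> K'"
      then obtain b' where b': "snd (?r c) < b'" "(fst c, b') \<in> K'" by blast
      then have "(fst c, b') \<in> ?r ` K" using cx by (simp add: K'_def)
      then obtain e where e: "snd (?r c) < b'" "(fst c, b') = ?r e" "e \<in> K" using b' by blast
      then have "fst e = fst c" by (metis fst_conv fst_raise_rook)
      moreover have "snd c < snd e"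
        using raise_rook_less_iff[OF m_pos, of c e "(x, y)"] e \<open>fst e = fst c\<close> by (metis snd_conv)
      ultimately show "\<exists>b'. snd c < b' \<and> (fst c, b') \<in> K" using e(3) by (metis prod.collapse)
    next
      assume "\<exists>b'. snd c < b' \<and> (fst c, b') \<in> K"
      then obtain b' where b': "snd c < b'" "(fst c, b') \<in> K" by blast
      then have "snd (?r c) < snd (?r (fst c, b'))"
        using raise_rook_less_iff[OF m_pos, of c "(fst c, b')" "(x, y)"] by simp
      moreover have "(fst c, snd (?r (fst c, b'))) \<in> K'"
        using b'(2) unfolding K'_def by (metis fst_conv fst_raise_rook image_eqI insertI2 prod.collapse)
      ultimately show "\<exists>b'. snd (?r c) < b' \<and> (fst c, b') \<in> K'" by blast
    qed
    moreover have "(\<exists>a' b'. a' < fst c \<and> level m b' = level m (snd (?r c)) \<and> (a', b') \<in> K') \<longleftrightarrow>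
        (\<exists>a' b'. a' < fst c \<and> level m b' = level m (snd c) \<and> (a', b') \<in> K)"
    proof -
      \<comment> \<open>If \<open>c\<close> is to the right of \<open>x\<close>, its level and that
        of the rook \<open>e\<close> undergo the same injective map. If \<open>c\<close> is to the
        left, so is \<open>e\<close>, and neither moves.\<close>
      have lev: "level m (snd (?r e)) = level m (snd (?r c)) \<longleftrightarrow> level m (snd e) = level m (snd c)"
        if "e \<in> K" "fst e < fst c" for e
        using r_level[OF that(1)] left_lower_level[OF that(1)] xK[OF that(1)] that cx
        by (auto simp: level_raise_rook m_pos split: if_splits)
      \<comment> \<open>The skipped level again: the new rook cancels none of the raised cells to
        its right.\<close>
      have "level m (snd (?r c)) \<noteq> level m y" if "x < fst c"
        using that by (auto simp: level_raise_rook m_pos)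
      then have "(\<exists>e\<in>K'. fst e < fst c \<and> level m (snd e) = level m (snd (?r c))) \<longleftrightarrow>
          (\<exists>e\<in>K. fst (?r e) < fst c \<and> level m (snd (?r e)) = level m (snd (?r c)))"
        unfolding K'_def by auto
      also have "\<dots> \<longleftrightarrow> (\<exists>e\<in>K. fst e < fst c \<and> level m (snd e) = level m (snd c))"
        using lev by auto
      finally show ?thesis unfolding Bex_def split_paired_Ex fst_conv snd_conv by blast
    qed
    ultimately show ?thesis by (simp add: uncancelled_def)
  qed
  have "?A' = ?r ` ?A \<union> ?new"
  proof (intro equalityI subsetI)
    fix c assume c: "c \<in> ?A'"
    obtain a b where ab: "c = (a, b)" by (cases c)
    have unc: "uncancelled m K' (a, b)" and cell: "a < N" "a \<notin> fst ` W'" "b < rank W' a * m"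
      using c ab by (auto simp: inset_cells_eq)
    show "c \<in> ?r ` ?A \<union> ?new"
    proof (cases "a = x")
      case True
      then have "b \<noteq> y" "\<not> b < y"
        using unc xyK' unfolding uncancelled_def fst_conv snd_conv by blast+
      then have "y < b" by simp
      then show ?thesis using True cell ab rank_le[of x] rank_left[of x] by simp
    next
      case False
      \<comment> \<open>The cells to the right in the level of \<open>y\<close> are cancelled by the
        new rook, so an uncancelled cell of a later column lies in the range of
        \<open>raise_rook\<close>.\<close>
      have neq: "level m b \<noteq> level m y" if "x < a"
        using unc xyK' that unfolding uncancelled_def fst_conv snd_conv by metis
      let ?d = "lower_rook m (x, y) (a, b)"
      have rd: "?r ?d = (a, b)" using neq by (intro raise_lower_rook m_pos) simp
      have "snd ?d < rank W a * m"
      proof (cases "a < x")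
        case True
        then show ?thesis using cell rank_le[of a] by (simp add: lower_rook_def)
      next
        case a: False
        then have xa: "x < a" using False by simp
        show ?thesis
        proof (cases "level m y < level m b")
          case True
          then have "b \<ge> m" by (metis level_def div_less leI not_less_zero)
          then show ?thesis using True xa cell rank_gt[OF xa] by (simp add: lower_rook_def)
        next
          case False
          \<comment> \<open>An unshifted cell still fits into the lower column: its level is below
            that of \<open>y\<close>, hence below \<open>x\<close>, and columns from
            \<open>x\<close> on keep rank at least \<open>x\<close>.\<close>
          then have "level m b < level m y" using neq xa by simp
          also have "\<dots> < x" using yx by (simp add: level_less_iff m_pos)
          also have "x \<le> rank W a" using rank_mono[of x a W] xa rank_left[of x] by simp
          finally have "b < rank W a * m" by (simp add: level_less_iff m_pos)
          then show ?thesis using False by (simp add: lower_rook_def)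
        qed
      qed
      moreover have "a \<notin> fst ` W" using cell W False by auto
      ultimately have "?d \<in> inset_cells m N W" using cell(1) by (auto simp: inset_cells_eq split_def)
      moreover have "uncancelled m K ?d" using uncancelled_raise[of ?d] rd unc False by simp
      ultimately have "?d \<in> ?A" by simp
      then have "?r ?d \<in> ?r ` ?A" by (rule imageI)
      then show ?thesis using rd ab by simp
    qed
  next
    fix c assume "c \<in> ?r ` ?A \<union> ?new"
    then show "c \<in> ?A'"
    proof
      assume "c \<in> ?r ` ?A"
      then obtain d where d: "d \<in> ?A" "c = ?r d" by auto
      then have "uncancelled m K' c" using uncancelled_raise A_col by simp
      moreover have "c \<in> inset_cells m N W'"
        using d raise_cell[of "fst d" "snd c" "snd d"]
        by (auto simp: inset_cells_eq split_def prod_eq_iff)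
      ultimately show ?thesis by simp
    next
      assume "c \<in> ?new"
      then obtain b where b: "c = (x, b)" "y < b" "b < x * m" by auto
      have "c \<in> inset_cells m N W'"
        using b xW' col rank_le[of x] rank_left[of x] by (simp add: inset_cells_eq)
      moreover have "uncancelled m K' c"
      proof -
        \<comment> \<open>Rooks to the left of \<open>x\<close> have not moved and lie in levels
          below that of \<open>y\<close>, so they cancel nothing above \<open>y\<close>.\<close>
        have "level m b' < level m b" if "(a, b') \<in> K'" "a < x" for a b'
        proof -
          have "(a, b') \<in> K" using that by (auto simp: K'_def raise_rook_def)
          then have "level m b' < level m y" using left_lower_level[of "(a, b')"] that by simp
          also have "\<dots> \<le> level m b" using b by (intro level_mono) simp
          finally show ?thesis .
        qed
        moreover have "b' = y" if "(x, b') \<in> K'" for b' using that noK by (auto simp: K'_def)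
        ultimately show ?thesis
          using b unfolding uncancelled_def b(1) fst_conv snd_conv by (metis less_asym less_irrefl)
      qed
      ultimately show ?thesis by simp
    qed
  qed
  moreover have "?r ` ?A \<inter> ?new = {}"
  proof (rule equals0I, elim IntE imageE)
    fix c d assume c: "c \<in> ?new" and d: "c = ?r d" "d \<in> ?A"
    have "fst c = x" using c by auto
    then show False using A_col[of d] d by simp
  qed
  moreover have "inj_on ?r ?A"
    by (rule inj_on_inverseI[of _ "lower_rook m (x, y)"]) (simp add: lower_raise_rook m_pos)
  ultimately have "card ?A' = card ?A + (x * m - 1 - y)"
    using finite_inset_cells by (simp add: card_Un_disjoint card_image card_cartesian_product)
  moreover have "(\<Sum>(a, b)\<in>W. a * m - 1 - b) = (x * m - 1 - y) + (\<Sum>(a, b)\<in>W'. a * m - 1 - b)"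
    using sum.remove[OF fin(1) xy, of "\<lambda>(a, b). a * m - 1 - b"] by (simp add: W'_def)
  ultimately show "statistic m N (W', K') = statistic m N (W, K)"
    by (simp add: statistic_def)
qed

text \<open>The fourth claim says that recolouring the rook once more restores \<open>K\<close>. As
  the image satisfies the assumptions of \<open>white_to_black\<close>, the change of the statistic
  and of the number of white rooks can be read off from there in reverse.\<close>

lemma black_to_white:
  assumes C: "(W, K) \<in> configurations m k B" and L: "is_leftmost_outside B (x, y) (W, K)"
    and xy: "(x, y) \<in> K"
  defines "W' \<equiv> insert (x, y) W" and "K' \<equiv> lower_rook m (x, y) ` (K - {(x, y)})"
  shows "(W', K') \<in> configurations m k B" "is_leftmost_outside B (x, y) (W', K')"
    "(x, y) \<notin> W" "insert (x, y) (raise_rook m (x, y) ` K') = K"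
proof -
  note left_lower_level = left_lower_level[OF C L] and rank_left = rank_left[OF C L]
  note col = leftmost_column[OF C L] and yx = leftmost_below_diagonal[OF C L]
  let ?l = "lower_rook m (x, y)"
  have fin: "finite W" "finite K" using configurations_finite[OF C] .
  have injW: "inj_on fst W" and naK: "nonattacking m K"
    and inW: "\<And>a b. (a, b) \<in> W \<Longrightarrow> a < N \<and> B ! a \<le> b \<and> b < a * m"
    and inK: "\<And>a b. (a, b) \<in> K \<Longrightarrow> a < N \<and> a \<notin> fst ` W \<and> b < rank W a * m"
    using C by (auto simp: configurations_iff)
  have xW: "x \<notin> fst ` W" using inK xy by blast
  then show xyW: "(x, y) \<notin> W" by force
  have other: "fst d \<noteq> x" "level m (snd d) \<noteq> level m y" if "d \<in> K - {(x, y)}" for d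
    using naK xy that unfolding nonattacking_def by fastforce+
  \<comment> \<open>Since \<open>(x, y)\<close> is a black rook, no other black rook shares its
    level, which is the side condition of \<open>raise_lower_rook\<close>.\<close>
  have rl: "raise_rook m (x, y) (?l d) = d" if "d \<in> K - {(x, y)}" for d
    using other[OF that] by (intro raise_lower_rook m_pos) simp
  then have "raise_rook m (x, y) ` K' = K - {(x, y)}" by (simp add: K'_def image_image)
  then show "insert (x, y) (raise_rook m (x, y) ` K') = K" using xy by auto
  have l_inj: "inj_on ?l (K - {(x, y)})" using rl by (rule inj_on_inverseI)
  have l_level: "level m (snd (?l d)) =
      (if level m y < level m (snd d) then level m (snd d) - 1 else level m (snd d))"
    if "d \<in> K - {(x, y)}" for d
    using left_lower_level[of d] other[OF that] that level_diff[of "level m y" m "snd d"]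
    by (auto simp: lower_rook_def)
  have rank_le: "rank W' a = rank W a" if "a \<le> x" for a
    using rank_insert_le[OF that] by (simp add: W'_def)
  have rank_gt: "Suc (rank W' a) = rank W a" if "x < a" for a
    using rank_insert_gt[OF that xW] by (simp add: W'_def)
  have "a < N \<and> a \<notin> fst ` W' \<and> b < rank W' a * m" if abK: "(a, b) \<in> K'" for a b
  proof -
    obtain d where d: "d \<in> K - {(x, y)}" "(a, b) = ?l d"
      using abK unfolding K'_def by blast
    then have a: "fst d = a" by (metis fst_conv fst_lower_rook)
    then have "(a, snd d) \<in> K" using d(1) by auto
    then have dK: "a < N" "a \<notin> fst ` W" "snd d < rank W a * m" using inK by blast+
    have "b < rank W' a * m"
    proof (cases "a < x")
      case True
      then show ?thesis using d dK a rank_le[of a] by (auto simp: lower_rook_def)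
    next
      case False
      then have xa: "x < a" using other[OF d(1)] a by simp
      show ?thesis
      proof (cases "level m y < level m (snd d)")
        case True
        then have "snd d \<ge> m" by (metis level_def div_less leI not_less_zero)
        then show ?thesis using True xa dK d a rank_gt[OF xa, symmetric] by (auto simp: lower_rook_def)
      next
        case False
        then have "level m (snd d) < level m y" using other[OF d(1)] by simp
        also have "\<dots> < x" using yx by (simp add: level_less_iff m_pos)
        also have "x \<le> rank W' a"
          using rank_mono[of x a W'] xa rank_left[of x] rank_le[of x] by simp
        finally have "snd d < rank W' a * m" by (simp add: level_less_iff m_pos)
        then show ?thesis using False d by (auto simp: lower_rook_def)
      qed
    qed
    then show ?thesis using dK other[OF d(1)] a by (auto simp: W'_def)
  qed
  \<comment> \<open>The levels above that of \<open>y\<close> drop by one into the level vacated by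
    the removed rook, so they remain distinct.\<close>
  moreover have "nonattacking m K'"
    unfolding nonattacking_def K'_def
  proof (intro ballI impI)
    fix c d assume "c \<in> ?l ` (K - {(x, y)})" "d \<in> ?l ` (K - {(x, y)})" and ne: "c \<noteq> d"
    then obtain e e' where e: "e \<in> K - {(x, y)}" "e' \<in> K - {(x, y)}" "c = ?l e" "d = ?l e'" by blast
    then have "e \<noteq> e'" using ne by blast
    then have "fst e \<noteq> fst e'" "level m (snd e) \<noteq> level m (snd e')"
      using naK e(1,2) by (simp_all add: nonattacking_def)
    then show "fst c \<noteq> fst d \<and> level m (snd c) \<noteq> level m (snd d)"
      using e(3,4) l_level[OF e(1)] l_level[OF e(2)] other(2)[OF e(1)] other(2)[OF e(2)]
      by (auto split: if_splits)
  qed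
  moreover have "card W' + card K' = k"
  proof -
    have "card K = Suc (card (K - {(x, y)}))" using fin xy by (metis card.remove)
    then show ?thesis using C fin xyW l_inj by (simp add: configurations_iff W'_def K'_def card_image)
  qed
  moreover have "inj_on fst W'" using injW xW by (auto simp: W'_def inj_on_def)
  moreover have "a < N \<and> B ! a \<le> b \<and> b < a * m" if "(a, b) \<in> W'" for a b
    using inW that col yx by (auto simp: W'_def)
  ultimately show "(W', K') \<in> configurations m k B" by (simp add: configurations_iff)
  have "fst d \<ge> x" if d: "d \<in> W' \<union> K'" "d \<notin> cells B" for d
  proof (rule ccontr)
    assume "\<not> x \<le> fst d"
    then have dx: "fst d < x" by simp
    then have "d \<in> W \<union> K" using d(1) by (auto simp: W'_def K'_def lower_rook_def)
    then show False using left_in_board[OF C L] dx d(2) by simp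
  qed
  moreover have "(x, y) \<notin> cells B" using col by (simp add: cells_def)
  moreover have "(x, y) \<in> W' \<union> K'" by (simp add: W'_def)
  ultimately show "is_leftmost_outside B (x, y) (W', K')"
    unfolding is_leftmost_outside_def split fst_conv by blast
qed

text \<open>The moved cell remains the leftmost one outside \<open>B\<close> and only changes
  colour, so the second application recolours the same cell back.\<close>

lemma involution_configuration:
  assumes C: "C \<in> configurations m k B"
  shows "involution m B C \<in> configurations m k B"
    "involution m B (involution m B C) = C"
    "statistic m N (involution m B C) = statistic m N C"
    "\<not> all_in_board B C \<Longrightarrow> even (card (fst (involution m B C))) \<longleftrightarrow> odd (card (fst C))"
proof -
  obtain W K where WK: "C = (W, K)" by (cases C)
  have "involution m B C \<in> configurations m k B \<and> involution m B (involution m B C) = C \<and>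
    statistic m N (involution m B C) = statistic m N C \<and>
    (\<not> all_in_board B C \<longrightarrow> (even (card (fst (involution m B C))) \<longleftrightarrow> odd (card (fst C))))"
  proof (cases "all_in_board B C")
    case True
    then show ?thesis using C by (simp add: involution_def)
  next
    case False
    have C': "(W, K) \<in> configurations m k B" using C WK by simp
    obtain x y where L: "is_leftmost_outside B (x, y) (W, K)"
      using is_leftmost_outside_exists[OF C'] False WK by (metis surj_pair)
    \<comment> \<open>Stated for any configuration with this leftmost cell, so that it evaluates
      both applications of the involution.\<close>
    have step: "involution m B (V, J) =
        (if (x, y) \<in> J then black_to_white m (x, y) (V, J) else white_to_black m (x, y) (V, J))"
      if "(V, J) \<in> configurations m k B" "is_leftmost_outside B (x, y) (V, J)" for V J
    proof -
      have "\<not> all_in_board B (V, J)"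
        using that(2) by (auto simp: all_in_board_def is_leftmost_outside_def)
      then show ?thesis using is_leftmost_outside_unique[OF that] by (simp add: involution_def Let_def)
    qed
    have disj: "(x, y) \<in> V \<Longrightarrow> (x, y) \<notin> J" if "(V, J) \<in> configurations m k B" for V J
      using that by (force simp: configurations_iff)
    show ?thesis
    proof (cases "(x, y) \<in> K")
      case True
      note bw = black_to_white[OF C' L True]
      let ?W' = "insert (x, y) W" and ?K' = "lower_rook m (x, y) ` (K - {(x, y)})"
      have I: "involution m B C = (?W', ?K')"
        using step[OF C' L] True WK by (simp add: black_to_white_eq)
      have "(x, y) \<in> ?W'" by simp
      note wb = white_to_black[OF bw(1,2) this]
      have W: "?W' - {(x, y)} = W" using bw(3) by simp
      have "involution m B (?W', ?K') = (W, K)"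
        using step[OF bw(1,2)] disj[OF bw(1)] bw(4) W by (simp add: white_to_black_eq)
      moreover have "statistic m N (W, K) = statistic m N (?W', ?K')"
        using wb(5) unfolding W bw(4) .
      moreover have "card ?W' = Suc (card W)" using wb(4) unfolding W .
      ultimately show ?thesis using I bw(1) WK by simp
    next
      case False
      then have xyW: "(x, y) \<in> W" using L by (auto simp: is_leftmost_outside_def)
      note wb = white_to_black[OF C' L xyW]
      let ?W' = "W - {(x, y)}" and ?K' = "insert (x, y) (raise_rook m (x, y) ` K)"
      have I: "involution m B C = (?W', ?K')"
        using step[OF C' L] False WK by (simp add: white_to_black_eq)
      have "involution m B (?W', ?K') = (insert (x, y) ?W', lower_rook m (x, y) ` (?K' - {(x, y)}))"
        using step[OF wb(1,2)] by (simp add: black_to_white_eq)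
      also have "\<dots> = (W, K)" unfolding wb(3) using xyW by auto
      finally show ?thesis using I wb(1,4,5) WK by simp
    qed
  qed
  then show "involution m B C \<in> configurations m k B"
    "involution m B (involution m B C) = C"
    "statistic m N (involution m B C) = statistic m N C"
    "\<not> all_in_board B C \<Longrightarrow> even (card (fst (involution m B C))) \<longleftrightarrow> odd (card (fst C))"
    by blast+
qed

end

section \<open>The transfer map\<close>

text \<open>The pairing inside \<open>transfer_white\<close> as a relation, which makes its symmetry
  in the two boards evident.\<close>

definition paired :: "nat \<Rightarrow> board \<Rightarrow> board \<Rightarrow> nat \<Rightarrow> nat \<Rightarrow> bool" where
  "paired m B B' x x' \<longleftrightarrow>
     (\<exists>d r. r < length (gap_columns m B d) \<and> r < length (gap_columns m B' d) \<and>
            x = gap_columns m B d ! r \<and> x' = gap_columns m B' d ! r)"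

lemma paired_sym: "paired m B B' x x' \<longleftrightarrow> paired m B' B x' x"
  unfolding paired_def by blast

lemma length_gap_columns: "length (gap_columns m B d) = count (gaps m B) d"
proof -
  have "count (mset (map f xs)) d = length (filter (\<lambda>j. f j = d) xs)" for f and xs :: "nat list"
    by (induction xs) auto
  then show ?thesis unfolding gap_columns_def gaps_def by (rule sym)
qed

lemma gap_columns_nth:
  assumes "r < length (gap_columns m B d)"
  shows "gap_columns m B d ! r < length B"
    "gap_columns m B d ! r * m - B ! (gap_columns m B d ! r) = d"
  using nth_mem[OF assms] unfolding gap_columns_def by auto

lemma paired_dest:
  assumes "paired m B B' x x'"
  shows "x < length B" "x' < length B'" "x * m - B ! x = x' * m - B' ! x'"
  using assms gap_columns_nth unfolding paired_def by (metis (no_types))+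

text \<open>Equal gap multisets give column lists of equal length for each gap, so every position in
  one list exists in the other.\<close>

lemma paired_total:
  assumes "gaps m B = gaps m B'" "x < length B"
  shows "\<exists>x'. paired m B B' x x'"
proof -
  let ?d = "x * m - B ! x"
  have "x \<in> set (gap_columns m B ?d)" using assms(2) by (simp add: gap_columns_def)
  then obtain r where "r < length (gap_columns m B ?d)" "x = gap_columns m B ?d ! r"
    by (metis in_set_conv_nth)
  moreover have "length (gap_columns m B ?d) = length (gap_columns m B' ?d)"
    using assms(1) by (simp add: length_gap_columns)
  ultimately show ?thesis unfolding paired_def by metis
qed

text \<open>A column determines its gap \<open>d\<close>, and, as the columns in a list are
  distinct, also its position \<open>r\<close>.\<close>

lemma paired_unique:
  assumes "paired m B B' x x'" "paired m B B' x y'"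
  shows "x' = y'"
proof -
  obtain d r where d: "r < length (gap_columns m B d)" "x = gap_columns m B d ! r"
    "x' = gap_columns m B' d ! r" using assms(1) unfolding paired_def by blast
  obtain e s where e: "s < length (gap_columns m B e)" "x = gap_columns m B e ! s"
    "y' = gap_columns m B' e ! s" using assms(2) unfolding paired_def by blast
  have "d = e" using gap_columns_nth(2)[OF d(1)] gap_columns_nth(2)[OF e(1)] d(2) e(2) by simp
  moreover have "distinct (gap_columns m B d)" by (simp add: gap_columns_def)
  ultimately have "r = s" using d e nth_eq_iff_index_eq by metis
  then show ?thesis using d e \<open>d = e\<close> by simp
qed

lemma transfer_white_eq:
  "transfer_white m B B' W = {(x', B' ! x' + i) | x x' i. (x, B ! x + i) \<in> W \<and> paired m B B' x x'}"
  unfolding transfer_white_def paired_def ..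

section \<open>The inset board in its own coordinates\<close>

definition embed :: "nat \<Rightarrow> cell set \<Rightarrow> cell \<Rightarrow> cell" where
  "embed N W = (\<lambda>(j, y). (inset_columns N W ! j, y))"

lemma embed_mem_iff:
  assumes "J \<subseteq> {..<length (inset_columns N W)} \<times> UNIV" "j < length (inset_columns N W)"
  shows "(inset_columns N W ! j, y) \<in> embed N W ` J \<longleftrightarrow> (j, y) \<in> J"
proof
  assume "(inset_columns N W ! j, y) \<in> embed N W ` J"
  then obtain i where "(i, y) \<in> J" "inset_columns N W ! j = inset_columns N W ! i"
    by (auto simp: embed_def)
  moreover from this have "i < length (inset_columns N W)" using assms(1) by auto
  ultimately show "(j, y) \<in> J" using inset_columns_less_iff(2)[OF assms(2)] by simp
qed (force simp: embed_def)

lemma inj_on_embed: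
  assumes "J \<subseteq> {..<length (inset_columns N W)} \<times> UNIV"
  shows "inj_on (embed N W) J"
proof (rule inj_onI)
  fix c d assume "c \<in> J" "d \<in> J" "embed N W c = embed N W d"
  moreover have "fst c < length (inset_columns N W)" "fst d < length (inset_columns N W)"
    using assms calculation(1,2) by auto
  ultimately show "c = d"
    using inset_columns_less_iff(2)[of "fst c" N W "fst d"] by (simp add: embed_def split_def prod_eq_iff)
qed

text \<open>\<open>embed N W\<close> is injective on the columns involved and keeps rows, so
  coincidences of columns and of levels are unchanged.\<close>

lemma nonattacking_embed:
  assumes "J \<subseteq> {..<length (inset_columns N W)} \<times> UNIV"
  shows "nonattacking m (embed N W ` J) \<longleftrightarrow> nonattacking m J"
proof -
  have "(embed N W c \<noteq> embed N W d) = (c \<noteq> d)"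
    "(fst (embed N W c) = fst (embed N W d)) = (fst c = fst d)"
    "snd (embed N W c) = snd c" if "c \<in> J" "d \<in> J" for c d
  proof -
    have "fst c < length (inset_columns N W)" "fst d < length (inset_columns N W)"
      using assms that by auto
    then show "(fst (embed N W c) = fst (embed N W d)) = (fst c = fst d)"
      using inset_columns_less_iff(2)[of "fst c" N W "fst d"] by (simp add: embed_def split_def)
    show "(embed N W c \<noteq> embed N W d) = (c \<noteq> d)"
      using inj_on_embed[OF assms] that by (auto simp: inj_on_def)
  qed (simp add: embed_def split_def)
  then show ?thesis unfolding nonattacking_def by simp
qed

lemma embed_subset_inset_cells:
  assumes "J \<subseteq> {..<length (inset_columns N W)} \<times> UNIV"
  shows "embed N W ` J \<subseteq> inset_cells m N W \<longleftrightarrow> (\<forall>(j, y)\<in>J. y < j * m)"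
proof -
  have "embed N W (j, y) \<in> inset_cells m N W \<longleftrightarrow> y < j * m" if "(j, y) \<in> J" for j y
  proof -
    have "j < length (inset_columns N W)" using assms that by auto
    then show ?thesis
      using inset_columns_nth[of j N W] by (simp add: embed_def inset_cells_eq rank_inset_columns)
  qed
  then show ?thesis by fastforce
qed

text \<open>The condition depends on columns only through their order, which the increasing list of
  inset columns respects.\<close>

lemma uncancelled_embed:
  assumes J: "J \<subseteq> {..<length (inset_columns N W)} \<times> UNIV" and j: "j < length (inset_columns N W)"
  shows "uncancelled m (embed N W ` J) (inset_columns N W ! j, y) \<longleftrightarrow> uncancelled m J (j, y)"
proof -
  have "(\<exists>x' y'. x' < inset_columns N W ! j \<and> level m y' = level m y \<and> (x', y') \<in> embed N W ` J) \<longleftrightarrow>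
      (\<exists>c\<in>J. inset_columns N W ! fst c < inset_columns N W ! j \<and> level m (snd c) = level m y)"
    by (force simp: embed_def)
  also have "\<dots> \<longleftrightarrow> (\<exists>c\<in>J. fst c < j \<and> level m (snd c) = level m y)"
  proof (rule bex_cong[OF refl])
    fix c assume "c \<in> J"
    then have "fst c < length (inset_columns N W)" using J by auto
    then show "(inset_columns N W ! fst c < inset_columns N W ! j \<and> level m (snd c) = level m y) =
        (fst c < j \<and> level m (snd c) = level m y)"
      using inset_columns_less_iff(1)[OF _ j] by simp
  qed
  also have "\<dots> \<longleftrightarrow> (\<exists>i y'. i < j \<and> level m y' = level m y \<and> (i, y') \<in> J)"
    unfolding Bex_def split_paired_Ex fst_conv snd_conv by blast
  finally show ?thesis by (simp add: uncancelled_def embed_mem_iff[OF J j])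
qed

text \<open>In inset coordinates the set depends on \<open>W\<close> only through the number of
  inset columns. Its size therefore agrees for any two sets of white rooks leaving equally many
  columns.\<close>

lemma uncancelled_inset_cells_embed:
  assumes J: "J \<subseteq> {..<length (inset_columns N W)} \<times> UNIV"
  shows "{c \<in> inset_cells m N W. uncancelled m (embed N W ` J) c} =
    embed N W ` {(j, y). j < length (inset_columns N W) \<and> y < j * m \<and> uncancelled m J (j, y)}"
    (is "?L = embed N W ` ?R")
proof (intro equalityI subsetI)
  fix c assume c: "c \<in> ?L"
  then obtain j y where "c = (inset_columns N W ! j, y)" "j < length (inset_columns N W)" "y < j * m"
    unfolding inset_cells_def by blast
  then have "(j, y) \<in> ?R" "c = embed N W (j, y)"
    using c uncancelled_embed[OF J] by (simp_all add: embed_def)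
  then show "c \<in> embed N W ` ?R" by blast
next
  fix c assume "c \<in> embed N W ` ?R"
  then obtain j y where c: "c = embed N W (j, y)" "j < length (inset_columns N W)" "y < j * m"
    "uncancelled m J (j, y)" by blast
  then have "c \<in> inset_cells m N W" unfolding inset_cells_def embed_def by auto
  moreover have "uncancelled m (embed N W ` J) c"
    using c uncancelled_embed[OF J] by (simp add: embed_def)
  ultimately show "c \<in> ?L" by simp
qed

lemma length_inset_columns:
  assumes "inj_on fst W" "fst ` W \<subseteq> {..<N}"
  shows "length (inset_columns N W) = N - card W"
proof -
  have "length (inset_columns N W) = card ({..<N} - fst ` W)"
    by (simp add: inset_columns_def)
  also have "\<dots> = N - card (fst ` W)"
    using assms(2) by (subst card_Diff_subset) (auto intro: finite_subset)
  finally show ?thesis using assms(1) by (simp add: card_image)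
qed

section \<open>Transfer between boards with the same gaps\<close>

locale paired_boards = B: covered_board m N B + B': covered_board m N B'
  for m N :: nat and B B' :: board +
  assumes gaps_eq: "gaps m B = gaps m B'"
begin

text \<open>Makes the results about the transfer available in the opposite direction, which is its
  inverse.\<close>

lemma flipped: "paired_boards m N B' B"
  using B.covered_board_axioms B'.covered_board_axioms gaps_eq
  by (simp add: paired_boards_def paired_boards_axioms_def)

definition partner :: "nat \<Rightarrow> nat" where
  "partner x = (SOME x'. paired m B B' x x')"

lemma paired_partner: "x < N \<Longrightarrow> paired m B B' x (partner x)"
  unfolding partner_def using paired_total[OF gaps_eq] B.length_B by (metis someI_ex)

lemma paired_iff: "x < N \<Longrightarrow> paired m B B' x x' \<longleftrightarrow> x' = partner x"
  using paired_partner paired_unique by metis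

lemma partner_less: "x < N \<Longrightarrow> partner x < N"
  using paired_dest(2)[OF paired_partner] B'.length_B by simp

lemma partner_gap: "x < N \<Longrightarrow> x * m - B ! x = partner x * m - B' ! partner x"
  using paired_dest(3)[OF paired_partner] .

lemma inj_on_partner: "inj_on partner {..<N}"
proof (rule inj_onI)
  fix x y assume "x \<in> {..<N}" "y \<in> {..<N}" "partner x = partner y"
  then have "paired m B' B (partner x) x" "paired m B' B (partner x) y"
    using paired_partner[of x] paired_partner[of y] by (simp_all add: paired_sym[of m B'])
  then show "x = y" by (rule paired_unique)
qed

definition move_white :: "cell \<Rightarrow> cell" where
  "move_white = (\<lambda>(x, y). (partner x, B' ! partner x + (y - B ! x)))"

context
  fixes W K :: "cell set" and k :: nat
  assumes C: "(W, K) \<in> configurations m k B"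
begin

lemma white_in_gap: "(x, y) \<in> W \<Longrightarrow> x < N \<and> B ! x \<le> y \<and> y < x * m"
  using C by (simp add: B.configurations_iff)

lemma transfer_white_image: "transfer_white m B B' W = move_white ` W"
proof (intro equalityI subsetI)
  fix c assume "c \<in> transfer_white m B B' W"
  then obtain x x' i where c: "c = (x', B' ! x' + i)" "(x, B ! x + i) \<in> W" "paired m B B' x x'"
    unfolding transfer_white_eq by blast
  then have "x' = partner x" using white_in_gap paired_iff by blast
  then show "c \<in> move_white ` W" using c by (auto simp: move_white_def intro!: image_eqI[OF _ c(2)])
next
  fix c assume "c \<in> move_white ` W"
  then obtain x y where xy: "c = move_white (x, y)" "(x, y) \<in> W" by auto
  then have "(x, B ! x + (y - B ! x)) \<in> W" "paired m B B' x (partner x)"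
    using white_in_gap paired_partner by auto
  then show "c \<in> transfer_white m B B' W"
    unfolding transfer_white_eq xy(1) move_white_def split by blast
qed

lemma inj_on_fst_move_white: "inj_on (fst \<circ> move_white) W"
proof (rule inj_onI)
  fix c d assume cd: "c \<in> W" "d \<in> W" "(fst \<circ> move_white) c = (fst \<circ> move_white) d"
  have "fst c < N" "fst d < N" using white_in_gap[of "fst c" "snd c"] white_in_gap[of "fst d" "snd d"] cd by auto
  then have "fst c = fst d"
    using cd(3) inj_on_partner by (auto simp: move_white_def split_def inj_on_def)
  moreover have "inj_on fst W" using C by (simp add: B.configurations_iff)
  ultimately show "c = d" using cd(1,2) by (simp add: inj_on_def)
qed

lemma card_transfer_white: "card (transfer_white m B B' W) = card W"
  unfolding transfer_white_image using inj_on_fst_move_white inj_on_imageI2 by (intro card_image) blast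

lemma transfer_white_in_gap:
  assumes "(x', y') \<in> transfer_white m B B' W"
  shows "x' < N \<and> B' ! x' \<le> y' \<and> y' < x' * m"
proof -
  obtain x y where xy: "(x, y) \<in> W" "x' = partner x" "y' = B' ! partner x + (y - B ! x)"
    using assms unfolding transfer_white_image move_white_def by auto
  then have "x < N" "B ! x \<le> y" "y < x * m" using white_in_gap by auto
  \<comment> \<open>The height of the rook above \<open>B\<close> is less than the gap of its
    column, and the partner column has the same gap.\<close>
  moreover have "y - B ! x < x' * m - B' ! x'"
    using partner_gap[of x] xy calculation by simp
  ultimately show ?thesis using xy partner_less by auto
qed

lemma transfer_white_back: "transfer_white m B' B (transfer_white m B B' W) = W"
proof -
  have "(x', B' ! x' + i) \<in> transfer_white m B B' W \<longleftrightarrow> (x, B ! x + i) \<in> W"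
    if p: "paired m B B' x x'" for x x' i
  proof
    assume "(x', B' ! x' + i) \<in> transfer_white m B B' W"
    then obtain z where z: "(z, B ! z + i) \<in> W" "paired m B B' z x'"
      unfolding transfer_white_eq by auto
    then have "z = x" using p paired_unique paired_sym by metis
    then show "(x, B ! x + i) \<in> W" using z by simp
  next
    assume "(x, B ! x + i) \<in> W"
    then show "(x', B' ! x' + i) \<in> transfer_white m B B' W" using p unfolding transfer_white_eq by blast
  qed
  then have "transfer_white m B' B (transfer_white m B B' W) =
      {(x, B ! x + i) | x x' i. (x, B ! x + i) \<in> W \<and> paired m B B' x x'}"
    unfolding transfer_white_eq[of m B' B] paired_sym[of m B' B] by blast
  also have "\<dots> = W"
  proof (intro equalityI subsetI)
    fix c assume c: "c \<in> W"
    obtain x y where xy: "c = (x, y)" by (cases c)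
    then have "x < N" "c = (x, B ! x + (y - B ! x))" using white_in_gap[of x y] c by auto
    then show "c \<in> {(x, B ! x + i) | x x' i. (x, B ! x + i) \<in> W \<and> paired m B B' x x'}"
      using c paired_partner by blast
  qed auto
  finally show ?thesis .
qed

text \<open>A white rook keeps its height above the board in a column with the same gap, so the
  number of cells above it within the gap is unchanged.\<close>

lemma sum_transfer_white:
  "(\<Sum>(x, y)\<in>transfer_white m B B' W. x * m - 1 - y) = (\<Sum>(x, y)\<in>W. x * m - 1 - y)"
proof -
  have "inj_on move_white W" using inj_on_fst_move_white inj_on_imageI2 by blast
  then have "(\<Sum>(x, y)\<in>transfer_white m B B' W. x * m - 1 - y) =
      (\<Sum>c\<in>W. (case move_white c of (x, y) \<Rightarrow> x * m - 1 - y))"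
    unfolding transfer_white_image by (simp add: sum.reindex)
  also have "\<dots> = (\<Sum>(x, y)\<in>W. x * m - 1 - y)"
  proof (rule sum.cong[OF refl])
    fix c assume c: "c \<in> W"
    obtain x y where xy: "c = (x, y)" by (cases c)
    then have w: "x < N" "B ! x \<le> y" "y < x * m" using white_in_gap c by auto
    have "B' ! partner x \<le> partner x * m" using B'.le_B partner_less w by simp
    then show "(case move_white c of (x, y) \<Rightarrow> x * m - 1 - y) = (case c of (x, y) \<Rightarrow> x * m - 1 - y)"
      using partner_gap[OF w(1)] w by (simp add: xy move_white_def)
  qed
  finally show ?thesis .
qed

lemma inset_columns_transfer_white:
  "length (inset_columns N (transfer_white m B B' W)) = length (inset_columns N W)"
proof -
  have "inj_on fst (transfer_white m B B' W)"
    unfolding transfer_white_image using inj_on_fst_move_white by (rule inj_on_imageI)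
  moreover have "fst ` transfer_white m B B' W \<subseteq> {..<N}" using transfer_white_in_gap by auto
  moreover have "inj_on fst W" using C by (simp add: B.configurations_iff)
  moreover have "fst ` W \<subseteq> {..<N}" using white_in_gap by auto
  ultimately show ?thesis by (simp add: length_inset_columns card_transfer_white)
qed

lemma transfer_configuration:
  shows "transfer m B B' (W, K) \<in> configurations m k B'"
    "card (fst (transfer m B B' (W, K))) = card W"
    "transfer m B' B (transfer m B B' (W, K)) = (W, K)"
    "statistic m N (transfer m B B' (W, K)) = statistic m N (W, K)"
proof -
  let ?W' = "transfer_white m B B' W"
  \<comment> \<open>The black rooks in inset coordinates. The transfer keeps \<open>J\<close> and
    replaces only the embedding given by \<open>W\<close>.\<close>
  define J where "J = {(j, y). j < length (inset_columns N W) \<and> (inset_columns N W ! j, y) \<in> K}"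
  let ?K' = "embed N ?W' ` J"
  \<comment> \<open>Stated for arbitrary \<open>V\<close> and \<open>V'\<close>, so that it
    evaluates the transfer and the transfer back.\<close>
  have pull: "transfer_black N V V' (embed N V ` J) = embed N V' ` J"
    if J: "J \<subseteq> {..<length (inset_columns N V)} \<times> UNIV" for V V'
  proof -
    have "transfer_black N V V' (embed N V ` J) =
        {(inset_columns N V' ! j, y) | j y. j < length (inset_columns N V) \<and> (j, y) \<in> J}"
      unfolding transfer_black_def using embed_mem_iff[OF J] by blast
    also have "\<dots> = embed N V' ` J" using J unfolding embed_def by force
    finally show ?thesis .
  qed
  have J: "J \<subseteq> {..<length (inset_columns N W)} \<times> UNIV" by (auto simp: J_def)
  then have J': "J \<subseteq> {..<length (inset_columns N ?W')} \<times> UNIV"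
    by (simp only: inset_columns_transfer_white)
  have Ksub: "K \<subseteq> inset_cells m N W" using C by (simp add: configurations_def B.length_B)
  have K: "K = embed N W ` J"
  proof (intro equalityI subsetI)
    fix c assume "c \<in> K"
    moreover from this obtain j y where "c = (inset_columns N W ! j, y)" "j < length (inset_columns N W)"
      using Ksub unfolding inset_cells_def by blast
    ultimately show "c \<in> embed N W ` J" unfolding embed_def J_def by force
  qed (auto simp: embed_def J_def)
  have T: "transfer m B B' (W, K) = (?W', ?K')"
    unfolding transfer_def split Let_def B.length_B K using pull[OF J] by simp
  then show "card (fst (transfer m B B' (W, K))) = card W" by (simp add: card_transfer_white)
  have "?K' \<subseteq> inset_cells m N ?W'"
    using Ksub unfolding K embed_subset_inset_cells[OF J] embed_subset_inset_cells[OF J'] .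
  moreover have "nonattacking m ?K'"
    using C unfolding B.configurations_iff K nonattacking_embed[OF J] nonattacking_embed[OF J'] by blast
  moreover have "card ?W' + card ?K' = k"
    using C unfolding B.configurations_iff K
    by (simp add: card_transfer_white card_image inj_on_embed[OF J] inj_on_embed[OF J'])
  moreover have "inj_on fst ?W'"
    unfolding transfer_white_image using inj_on_fst_move_white by (rule inj_on_imageI)
  ultimately show "transfer m B B' (W, K) \<in> configurations m k B'"
    unfolding T B'.configurations_iff using transfer_white_in_gap
    by (auto simp: inset_cells_eq)
  show "transfer m B' B (transfer m B B' (W, K)) = (W, K)"
    unfolding T using pull[OF J', of W] K
    by (simp add: transfer_def B'.length_B transfer_white_back)
  have "card {c \<in> inset_cells m N W. uncancelled m K c} =
      card {c \<in> inset_cells m N ?W'. uncancelled m ?K' c}"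
  proof -
    let ?R = "\<lambda>L. {(j, y). j < L \<and> y < j * m \<and> uncancelled m J (j, y)}"
    have R: "?R (length (inset_columns N V)) \<subseteq> {..<length (inset_columns N V)} \<times> UNIV" for V by auto
    show ?thesis
      unfolding K uncancelled_inset_cells_embed[OF J] uncancelled_inset_cells_embed[OF J']
        card_image[OF inj_on_embed[OF R]]
      by (simp only: inset_columns_transfer_white)
  qed
  then show "statistic m N (transfer m B B' (W, K)) = statistic m N (W, K)"
    unfolding T statistic_def split sum_transfer_white by simp
qed

end

lemma bij_betw_transfer:
  "bij_betw (transfer m B B') (configurations m k B) (configurations m k B')"
proof (rule bij_betw_byWitness[where f' = "transfer m B' B"])
  show "\<forall>C\<in>configurations m k B. transfer m B' B (transfer m B B' C) = C"
    using transfer_configuration(3) by auto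
  show "\<forall>C\<in>configurations m k B'. transfer m B B' (transfer m B' B C) = C"
    using paired_boards.transfer_configuration(3)[OF flipped] by auto
  show "transfer m B B' ` configurations m k B \<subseteq> configurations m k B'"
    using transfer_configuration(1) by auto
  show "transfer m B' B ` configurations m k B' \<subseteq> configurations m k B"
    using paired_boards.transfer_configuration(1)[OF flipped] by auto
qed

end

section \<open>The Garsia-Milne iteration\<close>

text \<open>\<open>P\<close> and \<open>P'\<close> stand for positive sign. If \<open>T'\<close>
  were never reached, the sequence would consist of positive elements of a finite set and, each step
  being invertible, would return to its start \<open>f t\<close>. The element \<open>x q\<close>
  before that return would satisfy \<open>I' (x q) = f t\<close>, so the sign-reversing
  \<open>I'\<close> would take a positive element to a positive one.\<close>

lemma garsia_milne_reaches:
  fixes f :: "'a \<Rightarrow> 'b" and P :: "'a \<Rightarrow> bool" and P' :: "'b \<Rightarrow> bool"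
  assumes fin: "finite S'" and f: "bij_betw f S S'"
    and I: "\<And>s. s \<in> S \<Longrightarrow> I s \<in> S" "\<And>s. s \<in> S \<Longrightarrow> I (I s) = s"
    and I': "\<And>s. s \<in> S' \<Longrightarrow> I' s \<in> S'" "\<And>s. s \<in> S' \<Longrightarrow> I' (I' s) = s"
    and sign_f: "\<And>s. s \<in> S \<Longrightarrow> P' (f s) \<longleftrightarrow> P s"
    and sign_I: "\<And>s. s \<in> S \<Longrightarrow> s \<notin> T \<Longrightarrow> P (I s) \<longleftrightarrow> \<not> P s"
    and sign_I': "\<And>s. s \<in> S' \<Longrightarrow> s \<notin> T' \<Longrightarrow> P' (I' s) \<longleftrightarrow> \<not> P' s"
    and sign_T: "\<And>s. s \<in> T \<Longrightarrow> P s"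
    and t: "t \<in> S" "t \<in> T" "I t = t"
  shows "\<exists>j. ((f \<circ> I \<circ> inv_into S f \<circ> I') ^^ j) (f t) \<in> T'"
proof (rule ccontr)
  assume never: "\<nexists>j. ((f \<circ> I \<circ> inv_into S f \<circ> I') ^^ j) (f t) \<in> T'"
  define h where "h = inv_into S f"
  define F where "F = f \<circ> I \<circ> h \<circ> I'"
  define x where "x j = (F ^^ j) (f t)" for j
  have out: "x j \<notin> T'" for j using never by (simp add: x_def F_def h_def)
  have x_Suc: "x (Suc j) = F (x j)" for j by (simp add: x_def)
  have f_in: "f s \<in> S'" if "s \<in> S" for s using f that by (auto simp: bij_betw_def)
  have h_in: "h s \<in> S" and fh: "f (h s) = s" if "s \<in> S'" for s
    using f that unfolding h_def bij_betw_def by (auto intro: inv_into_into f_inv_into_f)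
  have hf: "h (f s) = s" if "s \<in> S" for s
    using f that unfolding h_def bij_betw_def by (auto intro: inv_into_f_f)
  have F_in: "F s \<in> S'" if "s \<in> S'" for s using that by (simp add: F_def f_in I I' h_in)
  have x_in: "x j \<in> S'" for j
    by (induction j) (simp_all add: x_Suc F_in, simp add: x_def f_in t)
  \<comment> \<open>An explicit left inverse of \<open>F\<close> on \<open>S'\<close>. It lets a
    coincidence in the sequence be moved back to its start.\<close>
  have F_back: "I' (f (I (h (F s)))) = s" if "s \<in> S'" for s
    using that by (simp add: F_def hf fh I I' h_in)
  have pos: "P' (x j)" for j
  proof (induction j)
    case 0
    show ?case using t sign_f sign_T by (simp add: x_def)
  next
    case (Suc j)
    let ?u = "h (I' (x j))"
    have u: "?u \<in> S" using h_in I' x_in by simp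
    have "\<not> P' (f ?u)" using Suc sign_I'[OF x_in out] by (simp add: fh I' x_in)
    then have "\<not> P ?u" using sign_f[OF u] by simp
    \<comment> \<open>Elements of \<open>T\<close> are positive and \<open>?u\<close> is not, so
      \<open>?u\<close> lies outside \<open>T\<close> and \<open>I\<close> reverses its
      sign.\<close>
    then have "P (I ?u)" using sign_I[OF u] sign_T by blast
    then show ?case using sign_f[OF I(1)[OF u]] by (simp add: x_Suc F_def)
  qed
  have "\<not> inj x"
    using fin x_in by (metis finite_subset finite_image_iff image_subsetI infinite_UNIV_nat)
  then obtain a b where ab: "a < b" "x a = x b" by (metis injI linorder_neqE_nat)
  have "x (i + p) = x i \<Longrightarrow> x p = x 0" for i p
  proof (induction i)
    case (Suc i)
    then have "F (x (i + p)) = F (x i)" by (simp add: x_Suc)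
    then have "x (i + p) = x i" using F_back[OF x_in] by metis
    then show ?case by (rule Suc.IH)
  qed simp
  from this[of a "b - a"] ab have "x (b - a) = x 0" by simp
  moreover obtain q where "b - a = Suc q" using ab by (metis Suc_diff_Suc)
  ultimately have "F (x q) = f t" by (simp add: x_Suc) (simp add: x_def)
  then have "x q = I' (f (I (h (f t))))" using F_back[OF x_in, of q] by simp
  \<comment> \<open>Here \<open>I\<close> fixes the starting point \<open>t\<close>, so undoing one
    step from \<open>f t\<close> leaves only \<open>I'\<close>.\<close>
  then have "x q = I' (f t)" using t by (simp add: hf)
  then have "I' (x q) = f t" using I' f_in t by simp
  then have "P' (I' (x q))" using sign_f[OF t(1)] sign_T[OF t(2)] by simp
  then show False using sign_I'[OF x_in out] pos by simp
qed

lemma inversions_eq_uncancelled: "inversions m B \<pi> = card {c \<in> cells B. uncancelled m \<pi> c}"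
  unfolding inversions_def uncancelled_def by (rule arg_cong[of _ _ card]) auto

section \<open>The statistic on placements inside the board\<close>

context covered_board
begin

lemma cells_subset_Delta: "cells B \<subseteq> cells (Delta m N)"
  using le_B length_B by (fastforce simp: cells_def Delta_def)

lemma card_gap_cells: "card (cells (Delta m N) - cells B) = sum_mset (gaps m B)"
proof -
  have "cells (Delta m N) - cells B = (SIGMA x:{..<N}. {B ! x..<x * m})"
    by (auto simp: cells_def Delta_def length_B)
  then have "card (cells (Delta m N) - cells B) = (\<Sum>x<N. x * m - B ! x)" by simp
  also have "\<dots> = sum_mset (gaps m B)"
    by (simp add: gaps_def length_B sum_unfold_sum_mset atLeast0LessThan)
  finally show ?thesis .
qed

text \<open>Without white rooks the inset board is all of \<open>Delta m N\<close>. A cell above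
  \<open>B\<close> stays uncancelled: rooks in its column are below it, and a rook further left lies
  in a level that is full in this column of \<open>B\<close>, hence in a lower level.\<close>

lemma statistic_board_placement:
  assumes "\<pi> \<subseteq> cells B"
  shows "statistic m N ({}, \<pi>) = inversions m B \<pi> + sum_mset (gaps m B)"
proof -
  have "rank {} x = x" for x by (simp add: rank_def)
  then have inset: "inset_cells m N {} = cells (Delta m N)"
    by (auto simp: inset_cells_eq cells_def Delta_def)
  have "uncancelled m \<pi> c" if c: "c \<in> cells (Delta m N) - cells B" for c
  proof -
    obtain x y where xy: "c = (x, y)" by (cases c)
    have x: "x < N" "B ! x \<le> y" using c xy by (auto simp: cells_def Delta_def length_B)
    have "level m y' < level m y" if "(x', y') \<in> \<pi>" "x' < x" for x' y'
    proof -
      have "y' < B ! x'" using assms that by (auto simp: cells_def)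
      moreover have "covers m (B ! x') (B ! x)"
        using covers_B that x by (auto simp: sorted_wrt_iff_nth_less length_B)
      ultimately have "(level m y' + 1) * m \<le> y" using x by (auto simp: covers_def level_def)
      then show ?thesis using level_less_iff[OF m_pos, of y "level m y' + 1"] by simp
    qed
    moreover have "y' < y" if "(x, y') \<in> \<pi>" for y'
      using assms that x by (auto simp: cells_def)
    ultimately show ?thesis unfolding uncancelled_def xy fst_conv snd_conv
      by (metis less_asym less_irrefl)
  qed
  then have "{c \<in> cells (Delta m N). uncancelled m \<pi> c} =
      {c \<in> cells B. uncancelled m \<pi> c} \<union> (cells (Delta m N) - cells B)"
    using cells_subset_Delta by blast
  moreover have "card ({c \<in> cells B. uncancelled m \<pi> c} \<union> (cells (Delta m N) - cells B)) =
      card {c \<in> cells B. uncancelled m \<pi> c} + card (cells (Delta m N) - cells B)"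
    by (rule card_Un_disjoint) auto
  ultimately show ?thesis
    by (simp add: statistic_def inset inversions_eq_uncancelled card_gap_cells)
qed

lemma fixed_configurations_iff:
  "(W, K) \<in> fixed_configurations m k B \<longleftrightarrow> W = {} \<and> K \<in> rook_placements m k B"
proof
  assume "(W, K) \<in> fixed_configurations m k B"
  then have C: "(W, K) \<in> configurations m k B" and sub: "W \<subseteq> cells B" "K \<subseteq> cells B"
    by (auto simp: fixed_configurations_def all_in_board_def)
  have "W = {}" using C sub(1) by (auto simp: configurations_def)
  then show "W = {} \<and> K \<in> rook_placements m k B"
    using C sub(2) by (simp add: configurations_def rook_placements_def)
next
  assume *: "W = {} \<and> K \<in> rook_placements m k B"
  have "rank {} x = x" for x by (simp add: rank_def)
  moreover have "(x, y) \<in> K \<Longrightarrow> x < N \<and> y < x * m" for x y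
  proof -
    assume "(x, y) \<in> K"
    then have "(x, y) \<in> cells (Delta m N)"
      using * cells_subset_Delta by (auto simp: rook_placements_def)
    then show ?thesis by (auto simp: cells_def Delta_def)
  qed
  ultimately show "(W, K) \<in> fixed_configurations m k B"
    using * by (simp add: fixed_configurations_def all_in_board_def configurations_iff rook_placements_def)
qed

end

text \<open>Each of the four maps composed in one step keeps the statistic, so it is constant along
  the sequence. At both ends it exceeds the inversions by the sum of the gaps, which is the same for
  the two boards.\<close>

lemma (in paired_boards) inversions_garsia_milne:
  assumes \<pi>: "\<pi> \<in> rook_placements m k B"
  shows "inversions m B \<pi> = inversions m B' (garsia_milne m k B B' \<pi>)"
proof -
  let ?S = "configurations m k B" and ?S' = "configurations m k B'"
  let ?T = "fixed_configurations m k B" and ?T' = "fixed_configurations m k B'"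
  let ?f = "transfer m B B'"
  let ?t = "({}, \<pi>) :: configuration"
  let ?sgn = "\<lambda>C :: configuration. even (card (fst C))"
  define x where "x = garsia_milne_seq m k B B' ?t"
  have tT: "?t \<in> ?T" using \<pi> by (simp add: B.fixed_configurations_iff)
  then have tS: "?t \<in> ?S" by (simp add: fixed_configurations_def)
  have "\<exists>j. ((?f \<circ> involution m B \<circ> inv_into ?S ?f \<circ> involution m B') ^^ j) (?f ?t) \<in> ?T'"
  proof (rule garsia_milne_reaches[where P = ?sgn and P' = ?sgn and T = ?T and S' = ?S'])
    show "finite ?S'" by (rule B'.finite_configurations)
    show "bij_betw ?f ?S ?S'" by (rule bij_betw_transfer)
    show "?sgn (?f C) \<longleftrightarrow> ?sgn C" if "C \<in> ?S" for C
      using that transfer_configuration(2) by (cases C) auto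
    show "?sgn (involution m B C) \<longleftrightarrow> \<not> ?sgn C" if "C \<in> ?S" "C \<notin> ?T" for C
      using B.involution_configuration(4)[OF that(1)] that by (simp add: fixed_configurations_def)
    show "?sgn (involution m B' C) \<longleftrightarrow> \<not> ?sgn C" if "C \<in> ?S'" "C \<notin> ?T'" for C
      using B'.involution_configuration(4)[OF that(1)] that by (simp add: fixed_configurations_def)
    show "?sgn C" if "C \<in> ?T" for C
      using that by (cases C) (simp add: B.fixed_configurations_iff)
    show "involution m B ?t = ?t" using tT by (simp add: fixed_configurations_def involution_def)
  qed (use tT tS B.involution_configuration B'.involution_configuration in auto)
  then have "\<exists>j. x j \<in> ?T'" by (simp add: x_def garsia_milne_seq_def)
  \<comment> \<open>Since the sequence reaches \<open>?T'\<close>, the \<open>LEAST\<close> in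
    \<open>garsia_milne\<close> is an index at which it lies there.\<close>
  then have last: "x (LEAST j. x j \<in> ?T') \<in> ?T'" by (rule LeastI_ex)
  have inv: "x j \<in> ?S' \<and> statistic m N (x j) = statistic m N ?t" for j
  proof (induction j)
    case 0
    show ?case using transfer_configuration(1,4)[OF tS] by (simp add: x_def garsia_milne_seq_def)
  next
    case (Suc j)
    let ?u = "inv_into ?S ?f (involution m B' (x j))"
    have I': "involution m B' (x j) \<in> ?S'"
      "statistic m N (involution m B' (x j)) = statistic m N (x j)"
      using Suc B'.involution_configuration(1,3) by blast+
    have im: "?f ` ?S = ?S'" using bij_betw_transfer by (simp add: bij_betw_def)
    then have u: "?u \<in> ?S" "?f ?u = involution m B' (x j)"
      using I'(1) by (metis inv_into_into, metis f_inv_into_f)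
    have stat: "?f C \<in> ?S' \<and> statistic m N (?f C) = statistic m N C" if "C \<in> ?S" for C
      using that transfer_configuration(1,4) by (cases C) auto
    have "x (Suc j) = ?f (involution m B ?u)" by (simp add: x_def garsia_milne_seq_def)
    then show ?case
      using stat[of "involution m B ?u"] stat[OF u(1)] B.involution_configuration(1,3)[OF u(1)] u(2) I'(2) Suc
      by simp
  qed
  obtain \<pi>' where \<pi>': "x (LEAST j. x j \<in> ?T') = ({}, \<pi>')" "\<pi>' \<in> rook_placements m k B'"
    using last B'.fixed_configurations_iff by (metis surj_pair)
  have "statistic m N ({}, \<pi>') = statistic m N ?t" using inv \<pi>'(1) by metis
  moreover have "\<pi> \<subseteq> cells B" "\<pi>' \<subseteq> cells B'" using \<pi> \<pi>'(2) by (auto simp: rook_placements_def)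
  ultimately have "inversions m B \<pi> = inversions m B' \<pi>'"
    by (simp add: B.statistic_board_placement B'.statistic_board_placement gaps_eq)
  moreover have "garsia_milne m k B B' \<pi> = \<pi>'"
    using \<pi>'(1) by (simp add: garsia_milne_def Let_def flip: x_def)
  ultimately show ?thesis by simp
qed

section \<open>Application to padded singleton boards\<close>

lemma covered_board_pad:
  assumes "m \<ge> 1" "singleton_board m B" "fits_inside m N B"
  shows "covered_board m N (pad N B)"
proof
  show "0 < m" using assms(1) by simp
  show "length (pad N B) = N" using assms(3) by (simp add: fits_inside_def)
  show "sorted_wrt (covers m) (pad N B)"
    using singleton_board_covers[OF assms(1,2)] by (rule pad_covers)
  show "\<And>j. j < N \<Longrightarrow> pad N B ! j \<le> j * m" using fits_inside_le[OF assms(3)] .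
qed

theorem theorem23:
  fixes m N k :: nat and B B' :: board and \<pi> :: "cell set"
  assumes "m \<ge> 1"
    and "singleton_board m B" and "singleton_board m B'"
    and "rook_equivalent m B B'"
    and "fits_inside m N B" and "fits_inside m N B'"
    and "k < N"
    and "\<pi> \<in> rook_placements m k (pad N B)"
  shows "inversions m (pad N B) \<pi> =
         inversions m (pad N B') (garsia_milne m k (pad N B) (pad N B') \<pi>)"
proof (rule paired_boards.inversions_garsia_milne)
  show "paired_boards m N (pad N B) (pad N B')"
    unfolding paired_boards_def paired_boards_axioms_def
    using covered_board_pad[OF assms(1,2,5)] covered_board_pad[OF assms(1,3,6)]
      rook_equivalent_gaps_eq[OF assms(1-6)] by blast
qed (rule assms(8))

end
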